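(* Let $G=(V,E,W_E)$ be a connected weighted graph, let $d_i\le d_j$ (pointwise on $V\times V$) be cost-dominated path-representable distances on $G$, and let $p\ge1$. Then $$\mathrm{Diff}_p\bigl(\mathbf{bcd}_1(G,d_j),\mathbf{bcd}_1(G,d_i)\bigr)\le\gamma\,\lVert d_j-d_i\rVert_\infty,$$ where $\gamma=(|E|-|V|+1)^{1/p}$ and $\lVert d_j-d_i\rVert_\infty=\max_{v,w\in V}\bigl(d_j(v,w)-d_i(v,w)\bigr)$.
   Context: A weighted graph $G=(V,E,W_E)$ is a finite simple undirected graph with a function $W_E:E\to\mathbb{R}^{>0}$. Path choice function: for $v,w\in V$ let $P(v,w)$ be the set of paths from $v$ to $w$ with no repeated vertex, and $\mathcal{P}=\bigcup_{v,w\in V}P(v,w)$. A path choice function on $G$ is a function $g:V\times V\to\mathcal{P}$ with $g(v,w)\in P(v,w)$ for all $v,w$ and such that $g(a,b)\subseteq g(v,w)$ for all $v,w\in V$ and all vertices $a,b$ on $g(v,w)$ (consistency; $\subseteq$ means subpath). A function $d$ on $V\times V$ is a path-representable distance (represented by $g$) if there is a path choice function $g$ with $d(v,w)=\sum_{e\in g(v,w)}W_E(e)$ for $v\ne w$ and $d(v,v)=0$. It is cost-dominated if the representing $g$ satisfies: for every edge $e=(v,w)\in E$ with $g(v,w)\ne e$, $W_E(e)\ge\sum_{e'\in g(v,w)}W_E(e')$. Barcode and birth edges: for a distance $d$ on $V$, let $\mathbb{X}$ be the full simplicial complex on $V$ (all nonempty subsets), with $f(\sigma)=\max\{d(v,w)\mid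 v,w\in\sigma\}$ if $\dim\sigma\ge1$ and $f(\sigma)=0$ for vertices. A simplex ordering $\pi$ is a total order on $\mathbb{X}$ used to break ties: simplices are listed by increasing $f$, ties being broken first by dimension and then by $\pi$. Let $\mathbf{D}$ be the boundary matrix over $\mathbb{Z}/2\mathbb{Z}$ in this order ($\mathbf{D}_{a,b}=1$ iff $\sigma_a$ is a codimension-one face of $\sigma_b$), and $\mathbf{R}$ the reduced matrix obtained by the standard left-to-right column reduction (while some earlier column $b'<b$ has $\text{low}_{\mathbf{R}}(b')=\text{low}_{\mathbf{R}}(b)$, add column $b'$ to column $b$), where $\text{low}_{\mathbf{R}}(b)$ is the row index of the last nonzero entry of column $b$ (undefined for zero columns). The barcode $\mathbf{bcd}_1(G,d)$ (Vietoris--Rips persistence barcode of $(V,d)$ in dimension 1) consists of the intervals $[f(\sigma_a),f(\sigma_b)]$ with $\sigma_a$ a 1-simplex, $a=\text{low}_{\mathbf{R}}(b)$ and $f(\sigma_a)<f(\sigma_b)$. Each interval is indexed by its birth edge $\sigma_a$, which determines it uniquely. Total persistence difference: for cost-dominated path-representable $d_i\le d_j$, use a common simplex ordering $\pi$ for both distances for which the sets $\mathcal{B}_i,\mathcal{B}_j$ of birth edges of $\mathbf{bcd}_1(G,d_i),\mathbf{bcd}_1(G,d_j)$ satisfy $\mathcal{B}_i\subseteq\mathcal{B}_j$ (such an ordering exists; common birth edges $\sigma$ then satisfy $\beta^i_\sigma=\beta^j_\sigma$ and $\delta^i_\sigma\le\delta^j_\sigma$). Writing $(\beta^i_\sigma,\delta^i_\sigma)$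 and $(\beta^j_\sigma,\delta^j_\sigma)$ for the birth and death values of the intervals with birth edge $\sigma$ in $\mathbf{bcd}_1(G,d_i)$ and $\mathbf{bcd}_1(G,d_j)$, $$\mathrm{Diff}_p\bigl(\mathbf{bcd}_1(G,d_j),\mathbf{bcd}_1(G,d_i)\bigr)=\Bigl(\sum_{\sigma\in\mathcal{B}_i}(\delta^j_\sigma-\delta^i_\sigma)^p+\sum_{\sigma\in\mathcal{B}_j\setminus\mathcal{B}_i}(\delta^j_\sigma-\beta^j_\sigma)^p\Bigr)^{1/p}.$$ *)

theory Defs
  imports
    Complex_Main
    "HOL-Library.Sublist"
    "HOL-Library.While_Combinator"
    "HOL-Library.Z2"
    "Jordan_Normal_Form.Column_Operations"
begin

section \<open>Weighted graphs and cost-dominated path-representable distances\<close>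

definition weighted_graph :: "'a set \<Rightarrow> 'a set set \<Rightarrow> ('a set \<Rightarrow> real) \<Rightarrow> bool" where
  "weighted_graph V E W \<longleftrightarrow>
     finite V \<and> (\<forall>e\<in>E. e \<subseteq> V \<and> card e = 2) \<and> (\<forall>e\<in>E. W e > 0)"

fun path_edges :: "'a list \<Rightarrow> 'a set set" where
  "path_edges (u # v # p) = insert {u, v} (path_edges (v # p))"
| "path_edges _ = {}"

text \<open>Paths are vertex lists without repetition; \<open>[v]\<close> is the only path from \<open>v\<close> to \<open>v\<close>.\<close>

definition paths :: "'a set \<Rightarrow> 'a set set \<Rightarrow> 'a \<Rightarrow> 'a \<Rightarrow> 'a list set" where
  "paths V E v w =
     {p. p \<noteq> [] \<and> hd p = v \<and> last p = w \<and> distinct p \<and> set p \<subseteq> V \<and> path_edges p \<subseteq> E}"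

definition connected_graph :: "'a set \<Rightarrow> 'a set set \<Rightarrow> bool" where
  "connected_graph V E \<longleftrightarrow> V \<noteq> {} \<and> (\<forall>v\<in>V. \<forall>w\<in>V. paths V E v w \<noteq> {})"

text \<open>
  The graph is undirected, so a subpath may be traversed in the opposite direction.
  In particular, consistency of a path choice function makes \<open>g w v\<close> the reversal of \<open>g v w\<close>.
\<close>

definition subpath :: "'a list \<Rightarrow> 'a list \<Rightarrow> bool" where
  "subpath q p \<longleftrightarrow> sublist q p \<or> sublist (rev q) p"

definition path_choice_function ::
  "'a set \<Rightarrow> 'a set set \<Rightarrow> ('a \<Rightarrow> 'a \<Rightarrow> 'a list) \<Rightarrow> bool" where
  "path_choice_function V E g \<longleftrightarrow>
     (\<forall>v\<in>V. \<forall>w\<in>V. g v w \<in> paths V E v w) \<and>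
     (\<forall>v\<in>V. \<forall>w\<in>V. \<forall>a\<in>set (g v w). \<forall>b\<in>set (g v w). subpath (g a b) (g v w))"

definition path_cost :: "('a set \<Rightarrow> real) \<Rightarrow> 'a list \<Rightarrow> real" where
  "path_cost W p = (\<Sum>e\<in>path_edges p. W e)"

definition represented_by ::
  "'a set \<Rightarrow> 'a set set \<Rightarrow> ('a set \<Rightarrow> real) \<Rightarrow> ('a \<Rightarrow> 'a \<Rightarrow> real) \<Rightarrow> ('a \<Rightarrow> 'a \<Rightarrow> 'a list) \<Rightarrow> bool" where
  "represented_by V E W d g \<longleftrightarrow>
     path_choice_function V E g \<and>
     (\<forall>v\<in>V. \<forall>w\<in>V. d v w = (if v = w then 0 else path_cost W (g v w)))"

text \<open>The path \<open>[v, w]\<close> is the one consisting of the single edge \<open>{v, w}\<close>.\<close>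

definition cost_dominated_path_representable ::
  "'a set \<Rightarrow> 'a set set \<Rightarrow> ('a set \<Rightarrow> real) \<Rightarrow> ('a \<Rightarrow> 'a \<Rightarrow> real) \<Rightarrow> bool" where
  "cost_dominated_path_representable V E W d \<longleftrightarrow>
     (\<exists>g. represented_by V E W d g \<and>
       (\<forall>v w. {v, w} \<in> E \<and> g v w \<noteq> [v, w] \<longrightarrow> W {v, w} \<ge> path_cost W (g v w)))"

section \<open>The filtered full simplicial complex\<close>

definition full_complex :: "'a set \<Rightarrow> 'a set set" where
  "full_complex V = {\<sigma>. \<sigma> \<subseteq> V \<and> \<sigma> \<noteq> {}}"

definition filtration_value :: "('a \<Rightarrow> 'a \<Rightarrow> real) \<Rightarrow> 'a set \<Rightarrow> real" where
  "filtration_value d \<sigma> = (if card \<sigma> \<ge> 2 then Max {d v w | v w. v \<in> \<sigma> \<and> w \<in> \<sigma>} else 0)"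

definition simplex_ordering :: "'a set \<Rightarrow> 'a set rel \<Rightarrow> bool" where
  "simplex_ordering V \<pi> \<longleftrightarrow> linear_order_on (full_complex V) \<pi>"

text \<open>The strict order in which simplices are listed: by value, then by dimension, then by \<open>\<pi>\<close>.\<close>

definition simplex_less ::
  "('a \<Rightarrow> 'a \<Rightarrow> real) \<Rightarrow> 'a set rel \<Rightarrow> 'a set \<Rightarrow> 'a set \<Rightarrow> bool" where
  "simplex_less d \<pi> \<sigma> \<tau> \<longleftrightarrow>
     filtration_value d \<sigma> < filtration_value d \<tau> \<or>
     filtration_value d \<sigma> = filtration_value d \<tau> \<and>
       (card \<sigma> < card \<tau> \<or> card \<sigma> = card \<tau> \<and> \<sigma> \<noteq> \<tau> \<and> (\<sigma>, \<tau>) \<in> \<pi>)"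

definition simplex_list ::
  "'a set \<Rightarrow> ('a \<Rightarrow> 'a \<Rightarrow> real) \<Rightarrow> 'a set rel \<Rightarrow> 'a set list" where
  "simplex_list V d \<pi> = (THE xs. set xs = full_complex V \<and> sorted_wrt (simplex_less d \<pi>) xs)"

section \<open>Boundary matrix and its column reduction\<close>

definition boundary_matrix :: "'a set list \<Rightarrow> bit mat" where
  "boundary_matrix xs = mat (length xs) (length xs)
     (\<lambda>(a, b). of_bool (xs ! a \<subseteq> xs ! b \<and> card (xs ! b) = Suc (card (xs ! a))))"

definition low :: "bit mat \<Rightarrow> nat \<Rightarrow> nat option" where
  "low R b =
     (if \<exists>a<dim_row R. R $$ (a, b) \<noteq> 0
      then Some (Max {a. a < dim_row R \<and> R $$ (a, b) \<noteq> 0}) else None)"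

definition low_clash :: "bit mat \<Rightarrow> nat \<Rightarrow> nat \<Rightarrow> bool" where
  "low_clash R b b' \<longleftrightarrow> b' < b \<and> low R b \<noteq> None \<and> low R b' = low R b"

text \<open>
  \<open>addcol 1 b b' R\<close> adds column \<open>b'\<close> to column \<open>b\<close>. Columns are processed from left to right, so
  when column \<open>b\<close> is processed the earlier columns have pairwise distinct lows and \<open>b'\<close> is unique.
\<close>

definition reduce_column :: "nat \<Rightarrow> bit mat \<Rightarrow> bit mat" where
  "reduce_column b =
     while (\<lambda>R. \<exists>b'. low_clash R b b') (\<lambda>R. addcol 1 b (LEAST b'. low_clash R b b') R)"

definition reduced_matrix :: "bit mat \<Rightarrow> bit mat" where
  "reduced_matrix D = fold reduce_column [0..<dim_col D] D"

section \<open>Barcodes and total persistence difference\<close>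

text \<open>
  An interval \<open>[\<beta>, \<delta>]\<close> is recorded as a triple \<open>(\<sigma>, \<beta>, \<delta>)\<close> with its birth edge \<open>\<sigma>\<close>, so that
  equal intervals with distinct birth edges stay distinct.
\<close>

type_synonym 'a barcode = "('a set \<times> real \<times> real) set"

definition barcode1 :: "'a set \<Rightarrow> ('a \<Rightarrow> 'a \<Rightarrow> real) \<Rightarrow> 'a set rel \<Rightarrow> 'a barcode" where
  "barcode1 V d \<pi> =
     (let xs = simplex_list V d \<pi>; R = reduced_matrix (boundary_matrix xs) in
      {(xs ! a, filtration_value d (xs ! a), filtration_value d (xs ! b)) | a b.
         a < length xs \<and> b < length xs \<and> card (xs ! a) = 2 \<and> low R b = Some a \<and>
         filtration_value d (xs ! a) < filtration_value d (xs ! b)})"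

definition birth_edges :: "'a barcode \<Rightarrow> 'a set set" where
  "birth_edges B = fst ` B"

definition birth :: "'a barcode \<Rightarrow> 'a set \<Rightarrow> real" where
  "birth B \<sigma> = (THE \<beta>. \<exists>\<delta>. (\<sigma>, \<beta>, \<delta>) \<in> B)"

definition death :: "'a barcode \<Rightarrow> 'a set \<Rightarrow> real" where
  "death B \<sigma> = (THE \<delta>. \<exists>\<beta>. (\<sigma>, \<beta>, \<delta>) \<in> B)"

text \<open>
  Meant for barcodes \<open>B\<^sub>j\<close> and \<open>B\<^sub>i\<close> computed with a common simplex ordering for which
  \<open>birth_edges B\<^sub>i \<subseteq> birth_edges B\<^sub>j\<close>.
\<close>

definition pers_diff :: "real \<Rightarrow> 'a barcode \<Rightarrow> 'a barcode \<Rightarrow> real" where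
  "pers_diff p B\<^sub>j B\<^sub>i =
     ((\<Sum>\<sigma>\<in>birth_edges B\<^sub>i. (death B\<^sub>j \<sigma> - death B\<^sub>i \<sigma>) powr p) +
      (\<Sum>\<sigma>\<in>birth_edges B\<^sub>j - birth_edges B\<^sub>i. (death B\<^sub>j \<sigma> - birth B\<^sub>j \<sigma>) powr p)) powr (1 / p)"

definition sup_dist :: "'a set \<Rightarrow> ('a \<Rightarrow> 'a \<Rightarrow> real) \<Rightarrow> ('a \<Rightarrow> 'a \<Rightarrow> real) \<Rightarrow> real" where
  "sup_dist V d\<^sub>j d\<^sub>i = Max {d\<^sub>j v w - d\<^sub>i v w | v w. v \<in> V \<and> w \<in> V}"

end

theory Submission
  imports Defs
begin

text \<open>
  An edge \<open>\<sigma>\<close> dies by \<open>s\<close> iff some 2-chain of triangles of value at most \<open>s\<close> has \<open>\<sigma>\<close> as last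
  boundary edge, so the barcode can be computed with such chains instead of the reduced matrix.
  If the chosen path from \<open>v\<close> to \<open>w\<close> has an inner vertex, consistency makes all its other pairs
  strictly closer; hence coning off inside the path kills \<open>{v, w}\<close> at its birth, and every birth
  edge is an edge of \<open>G\<close> chosen as a path. For any cut of \<open>V\<close>, the smallest pair across it never
  dies, because a triangle crosses the cut evenly. So the edges of \<open>G\<close> that are not birth edges
  connect \<open>V\<close>, and there are at most \<open>|E| - |V| + 1\<close> birth edges.

  An edge \<open>e\<close> of \<open>G\<close> chosen by \<open>d\<^sub>i\<close> satisfies \<open>W e = d\<^sub>i e \<le> d\<^sub>j e \<le> W e\<close> by cost domination, so the two
  distances agree on it. A killing chain for \<open>d\<^sub>i\<close> can be modified so that its boundary consists of
  such edges only; it then kills the same edge for \<open>d\<^sub>j\<close>, with a delay of at most the distance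
  between \<open>d\<^sub>i\<close> and \<open>d\<^sub>j\<close>. Every summand of the total persistence difference is therefore at most
  that distance to the power \<open>p\<close>.
\<close>

section \<open>Column reduction modulo 2\<close>

text \<open>Keeps sums and products of bits in the language of the ring lemmas.\<close>

declare add_bit_eq_xor [simp del] mult_bit_eq_and [simp del]

lemma bit_add_self [simp]: "(x::bit) + x = 0"
  by (cases x) simp_all

lemma low_eq_Some_iff:
  "low R b = Some a \<longleftrightarrow>
     a < dim_row R \<and> R $$ (a, b) \<noteq> 0 \<and> (\<forall>a'<dim_row R. a < a' \<longrightarrow> R $$ (a', b) = 0)"
proof -
  let ?S = "{a. a < dim_row R \<and> R $$ (a, b) \<noteq> 0}"
  have fin: "finite ?S" by simp
  show ?thesis
  proof
    assume "low R b = Some a"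
    then have ne: "?S \<noteq> {}" and a: "a = Max ?S"
      by (auto simp: low_def split: if_splits)
    have "a \<in> ?S" using Max_in[OF fin ne] a by simp
    moreover have "a' \<le> a" if "a' \<in> ?S" for a'
      using Max_ge[OF fin that] a by simp
    ultimately show "a < dim_row R \<and> R $$ (a, b) \<noteq> 0 \<and> (\<forall>a'<dim_row R. a < a' \<longrightarrow> R $$ (a', b) = 0)"
      by fastforce
  next
    assume *: "a < dim_row R \<and> R $$ (a, b) \<noteq> 0 \<and> (\<forall>a'<dim_row R. a < a' \<longrightarrow> R $$ (a', b) = 0)"
    then have "Max ?S = a"
      by (intro Max_eqI[OF fin]) (auto simp: not_less[symmetric])
    then show "low R b = Some a" using * by (auto simp: low_def)
  qed
qed

lemma low_eq_None_iff: "low R b = None \<longleftrightarrow> (\<forall>a<dim_row R. R $$ (a, b) = 0)"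
  by (auto simp: low_def)

section \<open>Column spans and the invariant of the reduction\<close>

text \<open>A vector is a function on row indices that matters only below \<open>dim_row D\<close>.
  The bound \<open>b\<close> is exclusive: the columns available are those that left-to-right
  reduction may add to column \<open>b\<close>.\<close>

definition col_span :: "bit mat \<Rightarrow> nat \<Rightarrow> (nat \<Rightarrow> bit) \<Rightarrow> bool" where
  "col_span D b v \<longleftrightarrow> (\<exists>u. \<forall>a<dim_row D. v a = (\<Sum>l<b. u l * D $$ (a, l)))"

lemma col_span_zero: "col_span D b (\<lambda>a. 0)"
  unfolding col_span_def by (intro exI[of _ "\<lambda>_. 0"]) simp

lemma col_span_add:
  assumes "col_span D b v" "col_span D b w"
  shows "col_span D b (\<lambda>a. v a + w a)"
proof -
  obtain u u' where "\<forall>a<dim_row D. v a = (\<Sum>l<b. u l * D $$ (a, l))"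
    "\<forall>a<dim_row D. w a = (\<Sum>l<b. u' l * D $$ (a, l))"
    using assms unfolding col_span_def by auto
  then show ?thesis unfolding col_span_def
    by (intro exI[of _ "\<lambda>l. u l + u' l"]) (simp add: distrib_right sum.distrib)
qed

lemma col_span_mono:
  assumes "col_span D b v" "b \<le> b'"
  shows "col_span D b' v"
proof -
  obtain u where "\<forall>a<dim_row D. v a = (\<Sum>l<b. u l * D $$ (a, l))"
    using assms unfolding col_span_def by auto
  moreover have "(\<Sum>l<b. u l * D $$ (a, l)) = (\<Sum>l<b'. (if l < b then u l else 0) * D $$ (a, l))" for a
    using assms(2) by (intro sum.mono_neutral_cong_left) auto
  ultimately show ?thesis unfolding col_span_def
    by (intro exI[of _ "\<lambda>l. if l < b then u l else 0"]) simp
qed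

lemma col_span_column:
  assumes "k < b"
  shows "col_span D b (\<lambda>a. D $$ (a, k))"
  unfolding col_span_def using assms
  by (intro exI[of _ "\<lambda>l. if l = k then 1 else 0"])
    (simp add: if_distrib[of "\<lambda>x. x * _"] cong: if_cong)

text \<open>Modulo 2, the sum of a column of \<open>R\<close> and a column of \<open>D\<close> is their difference.\<close>

definition reduced_upto :: "bit mat \<Rightarrow> nat \<Rightarrow> bit mat \<Rightarrow> bool" where
  "reduced_upto D b R \<longleftrightarrow>
     dim_row R = dim_row D \<and> dim_col R = dim_col D \<and>
     (\<forall>k<dim_col D. b \<le> k \<longrightarrow> (\<forall>a<dim_row D. R $$ (a, k) = D $$ (a, k))) \<and>
     (\<forall>k<b. col_span D k (\<lambda>a. R $$ (a, k) + D $$ (a, k))) \<and>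
     (\<forall>k<b. \<forall>k'<b. low R k \<noteq> None \<longrightarrow> low R k = low R k' \<longrightarrow> k = k')"

lemma low_cong:
  assumes "dim_row R = dim_row R'" "\<And>a. a < dim_row R \<Longrightarrow> R $$ (a, k) = R' $$ (a, k')"
  shows "low R k = low R' k'"
proof (cases "low R' k'")
  case None
  then have "low R k = None" using assms by (simp add: low_eq_None_iff)
  then show ?thesis using None by simp
next
  case (Some a)
  then have "low R k = Some a" using assms by (simp add: low_eq_Some_iff)
  then show ?thesis using Some by simp
qed

text \<open>Two columns with a common low both have 1 there and vanish in all later rows, so their
  sum loses that entry. The measure sends a zero column to 0 and low \<open>a\<close> to
  \<open>Suc a\<close>, so that emptying a column with low 0 also counts as progress.\<close>

lemma low_addcol_decreases:
  assumes "low_clash R b b'" "b < dim_col R"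
  shows "(case low (addcol 1 b b' R) b of None \<Rightarrow> 0 | Some a \<Rightarrow> Suc a)
     < (case low R b of None \<Rightarrow> 0 | Some a \<Rightarrow> Suc a)"
proof -
  obtain a where a: "low R b = Some a" "low R b' = Some a" "b' < b"
    using assms(1) by (auto simp: low_clash_def)
  let ?R = "addcol 1 b b' R"
  have entry: "?R $$ (i, b) = R $$ (i, b') + R $$ (i, b)" if "i < dim_row R" for i
    using that assms(2) by (simp add: mat_addcol_def)
  have "?R $$ (i, b) = 0" if "i < dim_row R" "a \<le> i" for i
    using a(1,2) that entry[OF that(1)]
    by (cases "i = a") (auto simp: low_eq_Some_iff)
  then have "a' < a" if "low ?R b = Some a'" for a'
    using that unfolding low_eq_Some_iff by (metis index_mat_addcol(4) not_less)
  then show ?thesis using a(1) by (auto split: option.split)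
qed

lemma reduced_upto_reduce_column:
  assumes R: "reduced_upto D b R" and b: "b < dim_col D"
  shows "reduced_upto D (Suc b) (reduce_column b R)"
proof -
  \<comment> \<open>The loop invariant freezes every other column at its state in \<open>R\<close>
    and keeps column \<open>b\<close> equal to its original modulo earlier columns of
    \<open>D\<close>.\<close>
  define P where "P = (\<lambda>S. dim_row S = dim_row D \<and> dim_col S = dim_col D \<and>
     (\<forall>k<dim_col D. k \<noteq> b \<longrightarrow> (\<forall>a<dim_row D. S $$ (a, k) = R $$ (a, k))) \<and>
     col_span D b (\<lambda>a. S $$ (a, b) + D $$ (a, b)))"
  have "P (reduce_column b R) \<and> \<not> (\<exists>b'. low_clash (reduce_column b R) b b')"
    unfolding reduce_column_def
  proof (rule while_rule[where P = P and
        r = "measure (\<lambda>S. case low S b of None \<Rightarrow> 0 | Some a \<Rightarrow> Suc a)"])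
    show "P R"
      using R b col_span_zero[of D b]
      by (auto simp: P_def reduced_upto_def col_span_def)
  next
    fix S assume S: "P S" and "\<exists>b'. low_clash S b b'"
    define b' where "b' = (LEAST b'. low_clash S b b')"
    have clash: "low_clash S b b'"
      unfolding b'_def using \<open>\<exists>b'. low_clash S b b'\<close> by (rule LeastI_ex)
    then have b': "b' < b" by (simp add: low_clash_def)
    let ?S = "addcol 1 b b' S"
    have dims: "dim_row S = dim_row D" "dim_col S = dim_col D" using S by (auto simp: P_def)
    have eq: "S $$ (a, b') = R $$ (a, b')" if "a < dim_row D" for a
      using S b b' that by (auto simp: P_def)
    have "col_span D b' (\<lambda>a. R $$ (a, b') + D $$ (a, b'))"
      using R b' by (auto simp: reduced_upto_def)
    \<comment> \<open>Adding column \<open>b'\<close> of \<open>D\<close> a second time cancels it,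
      so column \<open>b'\<close> of \<open>R\<close> itself is a combination of columns before
      \<open>b\<close>.\<close>
    then have "col_span D b (\<lambda>a. R $$ (a, b') + D $$ (a, b') + D $$ (a, b'))"
      by (rule col_span_add[OF col_span_mono col_span_column]) (use b' in auto)
    moreover have "col_span D b (\<lambda>a. S $$ (a, b) + D $$ (a, b))" using S by (simp add: P_def)
    ultimately have "col_span D b (\<lambda>a. R $$ (a, b') + D $$ (a, b') + D $$ (a, b') +
        (S $$ (a, b) + D $$ (a, b)))"
      by (rule col_span_add)
    then have "col_span D b (\<lambda>a. ?S $$ (a, b) + D $$ (a, b))"
      using b b' dims eq by (simp add: col_span_def mat_addcol_def ac_simps)
    then show "P (addcol 1 b (LEAST b'. low_clash S b b') S)"
      using S b unfolding b'_def[symmetric] by (auto simp: P_def mat_addcol_def)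
    show "(addcol 1 b (LEAST b'. low_clash S b b') S, S)
        \<in> measure (\<lambda>S. case low S b of None \<Rightarrow> 0 | Some a \<Rightarrow> Suc a)"
      using low_addcol_decreases[OF clash] b dims unfolding b'_def[symmetric] by simp
  qed auto
  then obtain S where S: "S = reduce_column b R" "P S" "\<And>b'. \<not> low_clash S b b'" by blast
  have low: "low S k = low R k" if "k < b" for k
    using S(2) R b that by (intro low_cong) (auto simp: P_def reduced_upto_def)
  have "k = k'" if "k \<le> b" "k' \<le> b" "low S k \<noteq> None" "low S k = low S k'" for k k'
  proof (cases "k < b \<and> k' < b")
    case True
    then show ?thesis using R that low by (auto simp: reduced_upto_def)
  next
    case False
    then show ?thesis using S(3)[of k] S(3)[of k'] that
      by (auto simp: low_clash_def)
  qed
  moreover have "col_span D k (\<lambda>a. S $$ (a, k) + D $$ (a, k))" if "k \<le> b" for k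
  proof (cases "k = b")
    case False
    then have "col_span D k (\<lambda>a. R $$ (a, k) + D $$ (a, k))"
      using R that by (auto simp: reduced_upto_def)
    then show ?thesis using S(2) b that False by (auto simp: P_def col_span_def)
  qed (use S(2) in \<open>simp add: P_def\<close>)
  ultimately show ?thesis
    using S(2) R unfolding S(1)[symmetric] reduced_upto_def P_def less_Suc_eq_le
    by (smt (verit) Suc_le_eq not_less_iff_gr_or_eq less_imp_le_nat)
qed

lemma reduced_upto_reduced_matrix: "reduced_upto D (dim_col D) (reduced_matrix D)"
proof -
  have "reduced_upto D b (fold reduce_column [0..<b] D)" if "b \<le> dim_col D" for b
    using that
  proof (induction b)
    case 0
    then show ?case by (simp add: reduced_upto_def)
  next
    case (Suc b)
    then show ?case using reduced_upto_reduce_column[of D b] by simp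
  qed
  then show ?thesis by (simp add: reduced_matrix_def)
qed

lemma low_reduced_matrix_inj:
  assumes "low (reduced_matrix D) b = Some a" "low (reduced_matrix D) b' = Some a"
    "b < dim_col D" "b' < dim_col D"
  shows "b = b'"
  using reduced_upto_reduced_matrix[of D] assms unfolding reduced_upto_def
  by (metis option.distinct(1))

lemma col_span_reduced_column:
  assumes "b < dim_col D"
  shows "col_span D (Suc b) (\<lambda>a. reduced_matrix D $$ (a, b))"
proof -
  have "col_span D b (\<lambda>a. reduced_matrix D $$ (a, b) + D $$ (a, b))"
    using reduced_upto_reduced_matrix[of D] assms by (auto simp: reduced_upto_def)
  then have "col_span D (Suc b) (\<lambda>a. reduced_matrix D $$ (a, b) + D $$ (a, b) + D $$ (a, b))"
    by (rule col_span_add[OF col_span_mono col_span_column]) auto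
  then show ?thesis by (simp add: add.assoc)
qed

section \<open>Lows of combinations of columns\<close>

text \<open>The reduction is unitriangular: each reduced column is the original one plus earlier
  columns. Hence original columns can be exchanged for reduced ones, starting from the last.\<close>

lemma col_span_imp_reduced_combination:
  assumes "col_span D b v" "b \<le> dim_col D"
  shows "\<exists>u. \<forall>a<dim_row D. v a = (\<Sum>l<b. u l * reduced_matrix D $$ (a, l))"
  using assms
proof (induction b arbitrary: v)
  case 0
  then show ?case by (auto simp: col_span_def)
next
  case (Suc b)
  let ?R = "reduced_matrix D"
  obtain u where u: "\<forall>a<dim_row D. v a = (\<Sum>l<Suc b. u l * D $$ (a, l))"
    using Suc.prems by (auto simp: col_span_def)
  have "col_span D b (\<lambda>a. ?R $$ (a, b) + D $$ (a, b))"
    using reduced_upto_reduced_matrix[of D] Suc.prems(2) by (auto simp: reduced_upto_def)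
  then obtain w where w: "\<forall>a<dim_row D. ?R $$ (a, b) + D $$ (a, b) = (\<Sum>l<b. w l * D $$ (a, l))"
    by (auto simp: col_span_def)
  \<comment> \<open>Adding \<open>u b\<close> times the reduced column removes the coefficient at
    column \<open>b\<close> of \<open>D\<close>; the rest lies in the span of the earlier columns,
    where the induction hypothesis applies.\<close>
  have "col_span D b (\<lambda>a. v a + u b * ?R $$ (a, b))"
    unfolding col_span_def
  proof (intro exI[of _ "\<lambda>l. u l + u b * w l"] allI impI)
    fix a assume a: "a < dim_row D"
    have "v a + u b * ?R $$ (a, b) = (\<Sum>l<b. u l * D $$ (a, l)) + u b * (?R $$ (a, b) + D $$ (a, b))"
      using u a by (simp add: distrib_left ac_simps)
    also have "\<dots> = (\<Sum>l<b. (u l + u b * w l) * D $$ (a, l))"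
      using w a by (simp add: distrib_right sum.distrib sum_distrib_left mult.assoc)
    finally show "v a + u b * ?R $$ (a, b) = (\<Sum>l<b. (u l + u b * w l) * D $$ (a, l))" .
  qed
  then obtain z where z: "\<forall>a<dim_row D. v a + u b * ?R $$ (a, b) = (\<Sum>l<b. z l * ?R $$ (a, l))"
    using Suc.IH Suc.prems(2) by fastforce
  have "v a = (\<Sum>l<Suc b. (z(b := u b)) l * ?R $$ (a, l))" if "a < dim_row D" for a
  proof -
    have "(\<Sum>l<Suc b. (z(b := u b)) l * ?R $$ (a, l)) = v a + u b * ?R $$ (a, b) + u b * ?R $$ (a, b)"
      using z that by simp
    then show ?thesis by (simp add: add.assoc)
  qed
  then show ?case by blast
qed

text \<open>Distinct lows cannot cancel: in a combination of reduced columns the largest low among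
  the columns used survives, so it must be the last nonzero row of \<open>v\<close>.\<close>

lemma exists_low_reduced_matrix:
  assumes v: "col_span D b v" "b \<le> dim_col D"
    and a: "a < dim_row D" "v a \<noteq> 0" "\<And>a'. \<lbrakk>a' < dim_row D; a < a'\<rbrakk> \<Longrightarrow> v a' = 0"
  shows "\<exists>k<b. low (reduced_matrix D) k = Some a"
proof -
  let ?R = "reduced_matrix D"
  have dim: "dim_row ?R = dim_row D"
    using reduced_upto_reduced_matrix[of D] by (simp add: reduced_upto_def)
  obtain u where u: "\<forall>a<dim_row D. v a = (\<Sum>l<b. u l * ?R $$ (a, l))"
    using col_span_imp_reduced_combination[OF v] by blast
  \<comment> \<open>The lows of the columns with nonzero coefficient; zero columns have no low and
    drop out.\<close>
  define L where "L = {m. \<exists>k<b. u k \<noteq> 0 \<and> low ?R k = Some m}"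
  have "L \<subseteq> {..<dim_row D}" using dim by (auto simp: L_def low_eq_Some_iff)
  then have fin: "finite L" by (rule finite_subset) simp
  have ne: "L \<noteq> {}"
  proof
    assume L: "L = {}"
    have "u k * ?R $$ (a, k) = 0" if "k < b" for k
      using L that a(1) dim by (cases "low ?R k") (auto simp: L_def low_eq_None_iff)
    then have "v a = 0" using u a(1) by (simp del: mult_eq_0_iff)
    then show False using a(2) by simp
  qed
  define m where "m = Max L"
  obtain k where k: "k < b" "u k \<noteq> 0" "low ?R k = Some m"
    using Max_in[OF fin ne] by (auto simp: m_def L_def)
  have m: "m < dim_row D" "?R $$ (m, k) = 1" using k(3) dim by (auto simp: low_eq_Some_iff)
  have le: "m' \<le> m" if "l < b" "u l \<noteq> 0" "low ?R l = Some m'" for l m'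
    using Max_ge[OF fin, of m'] that by (auto simp: m_def L_def)
  have above: "u l * ?R $$ (r, l) = 0" if lr: "l < b" "r < dim_row D" "m < r" for l r
  proof (rule ccontr)
    assume nz: "u l * ?R $$ (r, l) \<noteq> 0"
    then obtain m' where m': "low ?R l = Some m'"
      using lr dim by (cases "low ?R l") (auto simp: low_eq_None_iff)
    then show False
      using le[OF lr(1) _ m'] nz lr dim by (auto simp: low_eq_Some_iff)
  qed
  \<comment> \<open>Another used column with an entry in row \<open>m\<close> would have its low at
    \<open>m\<close> by maximality, against the distinctness of lows.\<close>
  have at: "u l * ?R $$ (m, l) = 0" if "l < b" "l \<noteq> k" for l
  proof (rule ccontr)
    assume nz: "u l * ?R $$ (m, l) \<noteq> 0"
    then obtain m' where m': "low ?R l = Some m'"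
      using m dim by (cases "low ?R l") (auto simp: low_eq_None_iff)
    then have "m' = m"
      using le[OF that(1) _ m'] nz m dim by (force simp: low_eq_Some_iff)
    then show False
      using low_reduced_matrix_inj[of D l m k] m' k(1,3) that v(2) by auto
  qed
  have "u l * ?R $$ (m, l) = (if l = k then 1 else 0)" if "l \<in> {..<b}" for l
    using at[of l] that m(2) k(2) by (auto simp del: mult_eq_0_iff)
  then have "(\<Sum>l<b. u l * ?R $$ (m, l)) = (\<Sum>l<b. if l = k then 1 else 0)"
    by (rule sum.cong[OF refl])
  then have "v m \<noteq> 0" using u m(1) k(1) by simp
  moreover have "v r = 0" if "r < dim_row D" "m < r" for r
    using u above that by (simp del: mult_eq_0_iff)
  ultimately have "m = a" using a m by (metis linorder_neqE_nat)
  then show ?thesis using k by blast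
qed

section \<open>Birth and death in terms of chains\<close>

text \<open>The least element is forced to come first, and irreflexivity rules out repetitions. This
  makes the definite description in \<open>simplex_list\<close> meaningful.\<close>

lemma ex1_sorted_wrt:
  assumes "finite A" "irreflp_on A R" "transp_on A R" "totalp_on A R"
  shows "\<exists>!xs. set xs = A \<and> sorted_wrt R xs"
  using assms
proof (induction "card A" arbitrary: A)
  case 0
  then show ?case by auto
next
  case (Suc n)
  then have "A \<noteq> {}" by auto
  then obtain m where m: "m \<in> A" "\<forall>x\<in>A. x \<noteq> m \<longrightarrow> R m x"
    using Finite_Set.bex_least_element[of A R] Suc.prems by blast
  let ?B = "A - {m}"
  have sub: "irreflp_on ?B R" "transp_on ?B R" "totalp_on ?B R"
    using Suc.prems by (auto intro: irreflp_on_subset transp_on_subset totalp_on_subset)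
  have "n = card ?B" using Suc.hyps(2) m(1) Suc.prems(1) by simp
  then obtain xs where xs: "set xs = ?B" "sorted_wrt R xs"
    and uniq: "\<And>ys. set ys = ?B \<Longrightarrow> sorted_wrt R ys \<Longrightarrow> ys = xs"
    using Suc.hyps(1)[of ?B] Suc.prems(1) sub by auto
  show ?case
  proof (rule ex1I[of _ "m # xs"])
    show "set (m # xs) = A \<and> sorted_wrt R (m # xs)" using xs m by auto
  next
    fix zs assume zs: "set zs = A \<and> sorted_wrt R zs"
    then obtain z ys where zys: "zs = z # ys" using \<open>A \<noteq> {}\<close> by (cases zs) auto
    have "z = m"
    proof (rule ccontr)
      assume "z \<noteq> m"
      then have "m \<in> set ys" using zs zys m(1) by auto
      then have "R z m" "R m z" using zs zys m \<open>z \<noteq> m\<close> by auto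
      then have "R z z" using zs zys m(1) Suc.prems(3) by (auto dest: transp_onD)
      then show False using zs zys Suc.prems(2) by (auto dest: irreflp_onD)
    qed
    moreover have "m \<notin> set ys" using zs zys \<open>z = m\<close> m(1) Suc.prems(2) by (auto dest: irreflp_onD)
    ultimately show "zs = m # xs" using uniq[of ys] zs zys by auto
  qed
qed

lemma simplex_less_irrefl: "\<not> simplex_less d \<pi> \<sigma> \<sigma>"
  by (simp add: simplex_less_def)

context
  fixes V :: "'a set" and d :: "'a \<Rightarrow> 'a \<Rightarrow> real" and \<pi> :: "'a set rel"
  assumes fin: "finite V" and ord: "simplex_ordering V \<pi>"
begin

lemma transp_on_simplex_less: "transp_on (full_complex V) (simplex_less d \<pi>)"
proof -
  have "trans \<pi>" "antisym \<pi>"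
    using ord by (auto simp: simplex_ordering_def linear_order_on_def partial_order_on_def
        preorder_on_def)
  then show ?thesis
    unfolding transp_on_def simplex_less_def by (smt (verit) antisymD order_less_trans transD)
qed

lemma totalp_on_simplex_less: "totalp_on (full_complex V) (simplex_less d \<pi>)"
proof -
  have "total_on (full_complex V) \<pi>"
    using ord by (auto simp: simplex_ordering_def linear_order_on_def)
  then show ?thesis
    unfolding totalp_on_def total_on_def simplex_less_def by fastforce
qed

lemma simplex_list_set: "set (simplex_list V d \<pi>) = full_complex V"
  and simplex_list_sorted: "sorted_wrt (simplex_less d \<pi>) (simplex_list V d \<pi>)"
proof -
  have "finite (full_complex V)" using fin by (simp add: full_complex_def)
  then have "\<exists>!xs. set xs = full_complex V \<and> sorted_wrt (simplex_less d \<pi>) xs"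
    by (intro ex1_sorted_wrt transp_on_simplex_less totalp_on_simplex_less)
      (simp_all add: irreflp_on_def simplex_less_irrefl)
  from theI'[OF this] show "set (simplex_list V d \<pi>) = full_complex V"
    "sorted_wrt (simplex_less d \<pi>) (simplex_list V d \<pi>)"
    by (simp_all add: simplex_list_def)
qed

lemma simplex_list_less_iff:
  assumes "i < length (simplex_list V d \<pi>)" "j < length (simplex_list V d \<pi>)"
  shows "simplex_less d \<pi> (simplex_list V d \<pi> ! i) (simplex_list V d \<pi> ! j) \<longleftrightarrow> i < j"
proof -
  let ?xs = "simplex_list V d \<pi>"
  have *: "simplex_less d \<pi> (?xs ! i) (?xs ! j)" if "i < j" "j < length ?xs" for i j
    using simplex_list_sorted that by (rule sorted_wrt_nth_less)
  have "?xs ! i \<in> full_complex V" "?xs ! j \<in> full_complex V"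
    using nth_mem[OF assms(1)] nth_mem[OF assms(2)] simplex_list_set by simp_all
  then have "\<not> (simplex_less d \<pi> (?xs ! i) (?xs ! j) \<and> simplex_less d \<pi> (?xs ! j) (?xs ! i))"
    using transp_onD[OF transp_on_simplex_less, of "?xs ! i" "?xs ! j" "?xs ! i"]
      simplex_less_irrefl[of d \<pi> "?xs ! i"] by blast
  moreover have "?xs ! i = ?xs ! j" if "i = j" using that by simp
  ultimately show ?thesis
    using *[of i j] *[of j i] assms simplex_less_irrefl[of d \<pi> "?xs ! i"]
    by (cases i j rule: linorder_cases) auto
qed

lemma distinct_simplex_list: "distinct (simplex_list V d \<pi>)"
  unfolding distinct_conv_nth
proof (intro allI impI)
  fix i j assume ij: "i < length (simplex_list V d \<pi>)" "j < length (simplex_list V d \<pi>)" "i \<noteq> j"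
  show "simplex_list V d \<pi> ! i \<noteq> simplex_list V d \<pi> ! j"
  proof
    assume "simplex_list V d \<pi> ! i = simplex_list V d \<pi> ! j"
    then show False
      using simplex_list_less_iff[OF ij(1,2)] simplex_list_less_iff[OF ij(2,1)] ij(3)
      by (auto simp: simplex_less_irrefl)
  qed
qed

lemma filtration_value_simplex_list_mono:
  assumes "i \<le> j" "j < length (simplex_list V d \<pi>)"
  shows "filtration_value d (simplex_list V d \<pi> ! i) \<le> filtration_value d (simplex_list V d \<pi> ! j)"
  using simplex_list_less_iff[of i j] assms
  by (cases "i = j") (auto simp: simplex_less_def)

end

section \<open>Chains of triangles modulo 2\<close>

definition triangles :: "'a set \<Rightarrow> 'a set set" where
  "triangles V = {t. t \<subseteq> V \<and> card t = 3}"

definition vertex_pairs :: "'a set \<Rightarrow> 'a set set" where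
  "vertex_pairs V = {e. e \<subseteq> V \<and> card e = 2}"

text \<open>For a vertex pair \<open>e\<close>, this is its coefficient in the mod 2 boundary of the
  2-chain \<open>c\<close>, which is read only on triangles.\<close>

definition chain_boundary :: "'a set \<Rightarrow> ('a set \<Rightarrow> bit) \<Rightarrow> 'a set \<Rightarrow> bit" where
  "chain_boundary V c e = (\<Sum>t\<in>{t \<in> triangles V. e \<subseteq> t}. c t)"

text \<open>Triangles are bounded by value only, boundary edges by the full order: ties among edges
  decide which edge is the low, whereas ties among triangles do not change a death value.\<close>

definition dies_by :: "'a set \<Rightarrow> ('a \<Rightarrow> 'a \<Rightarrow> real) \<Rightarrow> 'a set rel \<Rightarrow> 'a set \<Rightarrow> real \<Rightarrow> bool" where
  "dies_by V d \<pi> \<sigma> s \<longleftrightarrow> (\<exists>c.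
     (\<forall>t\<in>triangles V. c t \<noteq> 0 \<longrightarrow> filtration_value d t \<le> s) \<and>
     chain_boundary V c \<sigma> \<noteq> 0 \<and>
     (\<forall>e\<in>vertex_pairs V. chain_boundary V c e \<noteq> 0 \<longrightarrow> e \<noteq> \<sigma> \<longrightarrow> simplex_less d \<pi> e \<sigma>))"

lemma finite_triangles [simp]: "finite V \<Longrightarrow> finite (triangles V)"
  by (rule finite_subset[of _ "Pow V"]) (auto simp: triangles_def)

lemma finite_vertex_pairs [simp]: "finite V \<Longrightarrow> finite (vertex_pairs V)"
  by (rule finite_subset[of _ "Pow V"]) (auto simp: vertex_pairs_def)

lemma dim_boundary_matrix [simp]:
  "dim_row (boundary_matrix xs) = length xs" "dim_col (boundary_matrix xs) = length xs"
  by (simp_all add: boundary_matrix_def)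

lemma dim_reduced_matrix [simp]: "dim_row (reduced_matrix D) = dim_row D"
  using reduced_upto_reduced_matrix[of D] by (simp add: reduced_upto_def)

text \<open>The row of an edge is nonzero only in the columns of the triangles containing it, so
  \<open>c\<close> may take any value on simplices of other dimensions. The last hypothesis lets the
  sum stop before column \<open>b\<close>.\<close>

lemma boundary_matrix_row_sum:
  assumes xs: "distinct xs" "set xs = full_complex V"
    and a: "a < length xs" "card (xs ! a) = 2" and b: "b \<le> length xs"
    and c: "\<And>l. l < length xs \<Longrightarrow> b \<le> l \<Longrightarrow> xs ! l \<in> triangles V \<Longrightarrow> c (xs ! l) = 0"
  shows "(\<Sum>l<b. c (xs ! l) * boundary_matrix xs $$ (a, l)) = chain_boundary V c (xs ! a)"
proof -
  let ?L = "{l. l < length xs \<and> xs ! l \<in> triangles V \<and> xs ! a \<subseteq> xs ! l}"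
  have "triangles V \<subseteq> set xs" using xs(2) by (auto simp: triangles_def full_complex_def)
  then have "bij_betw ((!) xs) ?L {t \<in> triangles V. xs ! a \<subseteq> t}"
    using xs(1) by (auto simp: bij_betw_def inj_on_def nth_eq_iff_index_eq in_set_conv_nth image_iff
        subset_iff)
  then have "chain_boundary V c (xs ! a) = (\<Sum>l\<in>?L. c (xs ! l))"
    unfolding chain_boundary_def by (rule sum.reindex_bij_betw[symmetric])
  also have "\<dots> = (\<Sum>l<length xs. if l \<in> ?L then c (xs ! l) else 0)"
    by (rule sum.mono_neutral_cong_left) auto
  also have "\<dots> = (\<Sum>l<b. if l \<in> ?L then c (xs ! l) else 0)"
    using b c by (intro sum.mono_neutral_right) auto
  also have "\<dots> = (\<Sum>l<b. c (xs ! l) * boundary_matrix xs $$ (a, l))"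
  proof (rule sum.cong[OF refl])
    fix l assume l: "l \<in> {..<b}"
    then have "xs ! l \<in> full_complex V" using nth_mem[of l xs] xs(2) b by simp
    then have "l \<in> ?L \<longleftrightarrow> xs ! a \<subseteq> xs ! l \<and> card (xs ! l) = Suc (card (xs ! a))"
      using l a b by (auto simp: triangles_def full_complex_def)
    then show "(if l \<in> ?L then c (xs ! l) else 0) = c (xs ! l) * boundary_matrix xs $$ (a, l)"
      using l a b by (auto simp: boundary_matrix_def)
  qed
  finally show ?thesis by simp
qed

section \<open>Translation between the reduced matrix and killing chains\<close>

context
  fixes V :: "'a set" and d :: "'a \<Rightarrow> 'a \<Rightarrow> real" and \<pi> :: "'a set rel"
    and xs :: "'a set list" and R :: "bit mat"
  assumes fin: "finite V" and ord: "simplex_ordering V \<pi>"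
  defines "xs \<equiv> simplex_list V d \<pi>"
  defines "R \<equiv> reduced_matrix (boundary_matrix xs)"
begin

lemma simplices_set: "set xs = full_complex V" and simplices_distinct: "distinct xs"
  unfolding xs_def using simplex_list_set distinct_simplex_list fin ord by auto

lemma vertex_pair_index:
  assumes "e \<in> vertex_pairs V"
  obtains a where "a < length xs" "xs ! a = e"
proof -
  have "e \<in> set xs" using assms simplices_set by (auto simp: vertex_pairs_def full_complex_def)
  then show ?thesis using that by (auto simp: in_set_conv_nth)
qed

text \<open>The coefficients that express reduced column \<open>k\<close> through columns of the
  boundary matrix form the killing chain.\<close>

lemma low_imp_dies_by:
  assumes k: "k < length xs" and low: "low R k = Some a" and card: "card (xs ! a) = 2"
  shows "dies_by V d \<pi> (xs ! a) (filtration_value d (xs ! k))"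
proof -
  obtain u where u: "\<forall>a<length xs. R $$ (a, k) = (\<Sum>l<Suc k. u l * boundary_matrix xs $$ (a, l))"
    using col_span_reduced_column[of k "boundary_matrix xs"] k by (auto simp: col_span_def R_def)
  have inj: "inj_on ((!) xs) {..<length xs}" using simplices_distinct by (simp add: inj_on_nth)
  define idx where "idx = inv_into {..<length xs} ((!) xs)"
  \<comment> \<open>\<open>idx\<close> recovers the position of a simplex in the list. Positions
    after \<open>k\<close> get coefficient 0, which bounds the values of the triangles in the
    chain.\<close>
  define c where "c = (\<lambda>t. if idx t \<le> k then u (idx t) else 0)"
  have idx: "idx (xs ! l) = l" if "l < length xs" for l
    using inv_into_f_f[OF inj] that by (simp add: idx_def)
  have bdry: "chain_boundary V c (xs ! a') = R $$ (a', k)"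
    if "a' < length xs" "card (xs ! a') = 2" for a'
  proof -
    have "chain_boundary V c (xs ! a') = (\<Sum>l<Suc k. c (xs ! l) * boundary_matrix xs $$ (a', l))"
      using that k simplices_set simplices_distinct idx
      by (intro boundary_matrix_row_sum[symmetric]) (auto simp: c_def)
    also have "\<dots> = (\<Sum>l<Suc k. u l * boundary_matrix xs $$ (a', l))"
      using k idx by (intro sum.cong) (auto simp: c_def)
    finally show ?thesis using u that by simp
  qed
  have a: "a < length xs" "R $$ (a, k) \<noteq> 0" "\<forall>a'<length xs. a < a' \<longrightarrow> R $$ (a', k) = 0"
    using low by (auto simp: low_eq_Some_iff R_def)
  show ?thesis unfolding dies_by_def
  proof (intro exI[of _ c] conjI ballI impI)
    fix t assume t: "t \<in> triangles V" "c t \<noteq> 0"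
    then have "t \<in> set xs" using simplices_set by (auto simp: triangles_def full_complex_def)
    then obtain l where l: "l < length xs" "xs ! l = t" by (auto simp: in_set_conv_nth)
    then have "l \<le> k" using t(2) idx by (auto simp: c_def split: if_splits)
    then show "filtration_value d t \<le> filtration_value d (xs ! k)"
      using filtration_value_simplex_list_mono[OF fin ord] k l unfolding xs_def by blast
  next
    show "chain_boundary V c (xs ! a) \<noteq> 0" using bdry[of a] a card by simp
  next
    fix e assume e: "e \<in> vertex_pairs V" "chain_boundary V c e \<noteq> 0" "e \<noteq> xs ! a"
    obtain a' where a': "a' < length xs" "xs ! a' = e" using vertex_pair_index[OF e(1)] .
    then have "R $$ (a', k) \<noteq> 0" using bdry[of a'] e by (simp add: vertex_pairs_def)
    then have "a' < a" using a a' e(3) by (metis linorder_neqE_nat)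
    then show "simplex_less d \<pi> e (xs ! a)"
      using simplex_list_less_iff[OF fin ord] a(1) a' unfolding xs_def by blast
  qed
qed

text \<open>A killing chain is a combination of columns whose last nonzero row is \<open>a\<close>,
  so some reduced column no later than its last triangle has that low.\<close>

lemma dies_by_imp_low:
  assumes dies: "dies_by V d \<pi> (xs ! a) s" and a: "a < length xs" "card (xs ! a) = 2"
  shows "\<exists>k<length xs. low R k = Some a \<and> filtration_value d (xs ! k) \<le> s"
proof -
  obtain c where c: "\<And>t. t \<in> triangles V \<Longrightarrow> c t \<noteq> 0 \<Longrightarrow> filtration_value d t \<le> s"
    "chain_boundary V c (xs ! a) \<noteq> 0"
    "\<And>e. e \<in> vertex_pairs V \<Longrightarrow> chain_boundary V c e \<noteq> 0 \<Longrightarrow> e \<noteq> xs ! a \<Longrightarrow>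
      simplex_less d \<pi> e (xs ! a)"
    using dies by (auto simp: dies_by_def)
  define T where "T = {l. l < length xs \<and> xs ! l \<in> triangles V \<and> c (xs ! l) \<noteq> 0}"
  have "T \<noteq> {}"
  proof
    assume "T = {}"
    have "c t = 0" if "t \<in> triangles V" for t
    proof -
      have "t \<in> set xs" using that simplices_set by (auto simp: triangles_def full_complex_def)
      then show ?thesis using \<open>T = {}\<close> that by (auto simp: T_def in_set_conv_nth)
    qed
    then show False using c(2) by (simp add: chain_boundary_def)
  qed
  moreover have "finite T" by (simp add: T_def)
  ultimately have M: "Max T \<in> T" "\<And>l. l \<in> T \<Longrightarrow> l \<le> Max T" by simp_all
  let ?D = "boundary_matrix xs" and ?b = "Suc (Max T)"
  \<comment> \<open>Restricting \<open>c\<close> to simplices with three vertices makes the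
    combination of columns vanish in all rows that are not edges.\<close>
  define c' where "c' = (\<lambda>t. if card t = 3 then c t else 0)"
  define v where "v = (\<lambda>r. if card (xs ! r) = 2 then chain_boundary V c (xs ! r) else 0)"
  have bdry: "chain_boundary V c' e = chain_boundary V c e" for e
    unfolding chain_boundary_def by (rule sum.cong) (auto simp: c'_def triangles_def)
  have b: "?b \<le> length xs" using M(1) by (simp add: T_def)
  have "(\<Sum>l<?b. c' (xs ! l) * ?D $$ (r, l)) = v r" if r: "r < length xs" for r
  proof (cases "card (xs ! r) = 2")
    case True
    have "c' (xs ! l) = 0" if "l < length xs" "?b \<le> l" "xs ! l \<in> triangles V" for l
    proof -
      have "l \<notin> T" using M(2)[of l] that(2) by auto
      then show ?thesis using that by (auto simp: T_def c'_def)
    qed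
    then show ?thesis
      using boundary_matrix_row_sum[OF simplices_distinct simplices_set r True b, of c'] True bdry
      by (simp add: v_def)
  next
    case False
    have "c' (xs ! l) * ?D $$ (r, l) = 0" if "l < ?b" for l
      using that b r False by (simp add: boundary_matrix_def c'_def)
    then show ?thesis using False by (simp add: v_def del: mult_eq_0_iff)
  qed
  then have "col_span ?D ?b v"
    unfolding col_span_def by (intro exI[of _ "\<lambda>l. c' (xs ! l)"]) simp
  moreover have "v a \<noteq> 0" using a c(2) by (simp add: v_def)
  moreover have "v r = 0" if "r < length xs" "a < r" for r
  proof (rule ccontr)
    assume "v r \<noteq> 0"
    then have r: "card (xs ! r) = 2" "chain_boundary V c (xs ! r) \<noteq> 0"
      by (auto simp: v_def split: if_splits)
    have "xs ! r \<in> vertex_pairs V"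
      using r(1) nth_mem[OF that(1)] simplices_set by (simp add: vertex_pairs_def full_complex_def)
    moreover have "xs ! r \<noteq> xs ! a" using that a(1) simplices_distinct by (simp add: nth_eq_iff_index_eq)
    ultimately have "simplex_less d \<pi> (xs ! r) (xs ! a)" using c(3) r(2) by blast
    then show False
      using simplex_list_less_iff[OF fin ord] that a(1) unfolding xs_def by (metis less_asym)
  qed
  ultimately obtain k where k: "k < ?b" "low R k = Some a"
    using exists_low_reduced_matrix[of ?D ?b v a] a(1) b by (auto simp: R_def)
  have "filtration_value d (xs ! k) \<le> filtration_value d (xs ! Max T)"
    using filtration_value_simplex_list_mono[OF fin ord] k(1) b unfolding xs_def
    by (simp add: less_Suc_eq_le Suc_le_eq)
  also have "\<dots> \<le> s" using M(1) c(1) by (simp add: T_def)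
  finally show ?thesis using k b by (meson less_le_trans)
qed

end

text \<open>All bounds \<open>s\<close> are at least the value of the unique reduced column with its
  low at \<open>\<sigma>\<close>, and that value is itself such a bound.\<close>

lemma dies_by_least:
  assumes "finite V" "simplex_ordering V \<pi>" "\<sigma> \<in> vertex_pairs V" "dies_by V d \<pi> \<sigma> s"
  obtains \<delta> where "dies_by V d \<pi> \<sigma> \<delta>" "\<And>s. dies_by V d \<pi> \<sigma> s \<Longrightarrow> \<delta> \<le> s"
proof -
  let ?xs = "simplex_list V d \<pi>"
  let ?R = "reduced_matrix (boundary_matrix ?xs)"
  obtain a where a: "a < length ?xs" "?xs ! a = \<sigma>"
    using vertex_pair_index[OF assms(1-3)] .
  have card: "card (?xs ! a) = 2" using a assms(3) by (simp add: vertex_pairs_def)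
  have ex: "\<exists>k<length ?xs. low ?R k = Some a \<and> filtration_value d (?xs ! k) \<le> s"
    if "dies_by V d \<pi> \<sigma> s" for s
    using dies_by_imp_low[OF assms(1,2)] that a card by blast
  obtain k where k: "k < length ?xs" "low ?R k = Some a"
    using ex[OF assms(4)] by blast
  show ?thesis
  proof (rule that[of "filtration_value d (?xs ! k)"])
    show "dies_by V d \<pi> \<sigma> (filtration_value d (?xs ! k))"
      using low_imp_dies_by[OF assms(1,2) k card] a by simp
    fix s assume "dies_by V d \<pi> \<sigma> s"
    then obtain k' where k': "k' < length ?xs" "low ?R k' = Some a"
      "filtration_value d (?xs ! k') \<le> s"
      using ex by blast
    then show "filtration_value d (?xs ! k) \<le> s"
      using low_reduced_matrix_inj[OF k(2) k'(2)] k k' by simp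
  qed
qed

text \<open>Since lows are distinct, the column paired with \<open>\<sigma>\<close> is unique and
  its value is the least death bound. From here on chains replace the matrix.\<close>

lemma barcode1_iff:
  assumes V: "finite V" "simplex_ordering V \<pi>"
  shows "(\<sigma>, \<beta>, \<delta>) \<in> barcode1 V d \<pi> \<longleftrightarrow>
    \<sigma> \<in> vertex_pairs V \<and> \<beta> = filtration_value d \<sigma> \<and> \<beta> < \<delta> \<and>
    dies_by V d \<pi> \<sigma> \<delta> \<and> (\<forall>s. dies_by V d \<pi> \<sigma> s \<longrightarrow> \<delta> \<le> s)" (is "?L \<longleftrightarrow> ?rhs")
proof -
  let ?xs = "simplex_list V d \<pi>"
  let ?R = "reduced_matrix (boundary_matrix ?xs)"
  have set: "set ?xs = full_complex V" by (rule simplex_list_set[OF V])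
  show ?thesis
  proof
    assume ?L
    then obtain a b where ab: "a < length ?xs" "b < length ?xs" "card (?xs ! a) = 2"
      "low ?R b = Some a" "\<sigma> = ?xs ! a" "\<beta> = filtration_value d \<sigma>"
      "\<delta> = filtration_value d (?xs ! b)" "\<beta> < \<delta>"
      by (auto simp: barcode1_def Let_def)
    have "\<sigma> \<in> vertex_pairs V"
      using ab nth_mem[OF ab(1)] set by (auto simp: vertex_pairs_def full_complex_def)
    moreover have "dies_by V d \<pi> \<sigma> \<delta>"
      using low_imp_dies_by[OF V ab(2,4,3)] ab by simp
    moreover have "\<delta> \<le> s" if dies: "dies_by V d \<pi> \<sigma> s" for s
    proof -
      obtain k where k: "k < length ?xs" "low ?R k = Some a" "filtration_value d (?xs ! k) \<le> s"
        using dies_by_imp_low[OF V _ ab(1,3)] dies ab(5) by blast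
      then show ?thesis using low_reduced_matrix_inj[OF k(2) ab(4)] ab by simp
    qed
    ultimately show ?rhs using ab by blast
  next
    assume r: ?rhs
    then obtain a where a: "a < length ?xs" "?xs ! a = \<sigma>"
      using vertex_pair_index[OF V] by blast
    have card: "card (?xs ! a) = 2" using a r by (simp add: vertex_pairs_def)
    obtain k where k: "k < length ?xs" "low ?R k = Some a" "filtration_value d (?xs ! k) \<le> \<delta>"
      using dies_by_imp_low[OF V _ a(1) card] r a(2) by blast
    moreover have "\<delta> \<le> filtration_value d (?xs ! k)"
      using r low_imp_dies_by[OF V k(1,2) card] a(2) by blast
    ultimately show ?L using a card r by (fastforce simp: barcode1_def Let_def)
  qed
qed

section \<open>Rules for boundaries and filtration values\<close>

lemma chain_boundary_add:
  "chain_boundary V (\<lambda>t. c t + c' t) e = chain_boundary V c e + chain_boundary V c' e"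
  by (simp add: chain_boundary_def sum.distrib)

lemma chain_boundary_sum:
  "chain_boundary V (\<lambda>t. \<Sum>x\<in>X. c x t) e = (\<Sum>x\<in>X. chain_boundary V (c x) e)"
  unfolding chain_boundary_def by (rule sum.swap)

lemma chain_boundary_indicator:
  assumes "finite V" "s \<in> triangles V"
  shows "chain_boundary V (\<lambda>t. of_bool (t = s)) e = of_bool (e \<subseteq> s)"
proof -
  have "finite {t \<in> triangles V. e \<subseteq> t}" using assms(1) by simp
  then show ?thesis
    using assms(2) by (simp add: chain_boundary_def of_bool_def)
qed

lemma filtration_value_le_iff:
  assumes "card \<sigma> \<ge> 2"
  shows "filtration_value d \<sigma> \<le> s \<longleftrightarrow> (\<forall>v\<in>\<sigma>. \<forall>w\<in>\<sigma>. d v w \<le> s)"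
proof -
  have "finite \<sigma>" "\<sigma> \<noteq> {}" using assms by (auto intro: card_ge_0_finite)
  moreover have "{d v w | v w. v \<in> \<sigma> \<and> w \<in> \<sigma>} = (\<lambda>(v, w). d v w) ` (\<sigma> \<times> \<sigma>)" by auto
  ultimately show ?thesis using assms by (simp add: filtration_value_def)
qed

lemma filtration_value_mono:
  assumes "\<sigma> \<subseteq> \<tau>" "card \<sigma> \<ge> 2" "finite \<tau>"
  shows "filtration_value d \<sigma> \<le> filtration_value d \<tau>"
proof -
  have "card \<tau> \<ge> 2" using card_mono[OF assms(3,1)] assms(2) by simp
  then have "\<forall>v\<in>\<tau>. \<forall>w\<in>\<tau>. d v w \<le> filtration_value d \<tau>"
    using filtration_value_le_iff[of \<tau> d] by blast
  then show ?thesis using assms(1,2) by (auto simp: filtration_value_le_iff)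
qed

text \<open>Every pair outside \<open>N\<close> is homologous to a sum of cheaper edges of \<open>N\<close> as soon as it appears.\<close>

definition generating_edges ::
  "'a set \<Rightarrow> ('a set \<Rightarrow> real) \<Rightarrow> ('a \<Rightarrow> 'a \<Rightarrow> real) \<Rightarrow> 'a set set \<Rightarrow> bool" where
  "generating_edges V W d N \<longleftrightarrow>
     (\<forall>e\<in>N. filtration_value d e = W e) \<and>
     (\<forall>e\<in>vertex_pairs V - N. \<exists>c.
        (\<forall>t\<in>triangles V. c t \<noteq> 0 \<longrightarrow> filtration_value d t \<le> filtration_value d e) \<and>
        (\<forall>a\<in>vertex_pairs V. chain_boundary V c a + of_bool (a = e) \<noteq> 0 \<longrightarrow>
           a \<in> N \<and> W a < filtration_value d e))"

section \<open>Fillings from path choice functions\<close>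

lemma path_edges_iff:
  "e \<in> path_edges p \<longleftrightarrow> (\<exists>xs u v ys. p = xs @ u # v # ys \<and> e = {u, v})"
proof (induction p rule: path_edges.induct)
  case (1 u v p)
  show ?case
  proof
    assume "e \<in> path_edges (u # v # p)"
    then consider "e = {u, v}" | "e \<in> path_edges (v # p)" by auto
    then show "\<exists>xs u' v' ys. u # v # p = xs @ u' # v' # ys \<and> e = {u', v'}"
    proof cases
      case 1
      then show ?thesis by (intro exI[of _ "[]"]) auto
    next
      case 2
      then obtain xs u' v' ys where "v # p = xs @ u' # v' # ys" "e = {u', v'}"
        using "1.IH" by blast
      then show ?thesis by (intro exI[of _ "u # xs"]) auto
    qed
  next
    assume "\<exists>xs u' v' ys. u # v # p = xs @ u' # v' # ys \<and> e = {u', v'}"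
    then obtain xs u' v' ys where *: "u # v # p = xs @ u' # v' # ys" "e = {u', v'}" by blast
    show "e \<in> path_edges (u # v # p)"
    proof (cases xs)
      case Nil
      then show ?thesis using * by simp
    next
      case (Cons z zs)
      then have "v # p = zs @ u' # v' # ys" using * by simp
      then have "e \<in> path_edges (v # p)" using "1.IH" * by blast
      then show ?thesis by simp
    qed
  qed
qed (auto simp: Cons_eq_append_conv)

lemma path_edges_rev: "path_edges (rev p) = path_edges p"
proof -
  have "e \<in> path_edges (rev p)" if e: "e \<in> path_edges p" for e and p :: "'a list"
  proof -
    obtain xs u v ys where "p = xs @ u # v # ys" "e = {u, v}"
      using e by (auto simp: path_edges_iff)
    then have "rev p = rev ys @ v # u # rev xs" "e = {v, u}" by auto
    then show ?thesis unfolding path_edges_iff by blast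
  qed
  from this[of _ p] this[of _ "rev p"] show ?thesis by auto
qed

lemma path_edges_sublist:
  assumes "sublist q p"
  shows "path_edges q \<subseteq> path_edges p"
proof
  fix e assume "e \<in> path_edges q"
  then obtain xs u v ys where "q = xs @ u # v # ys" "e = {u, v}"
    by (auto simp: path_edges_iff)
  moreover obtain as bs where "p = as @ q @ bs" using assms by (auto simp: sublist_def)
  ultimately have "p = (as @ xs) @ u # v # (ys @ bs)" "e = {u, v}" by auto
  then show "e \<in> path_edges p" unfolding path_edges_iff by blast
qed

lemma path_edges_subpath: "subpath q p \<Longrightarrow> path_edges q \<subseteq> path_edges p"
  using path_edges_sublist[of q p] path_edges_sublist[of "rev q" p]
  by (auto simp: subpath_def path_edges_rev)

lemma subpath_antisym:
  assumes "subpath q p" "subpath p q"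
  shows "q = p \<or> q = rev p"
proof -
  have "length q \<le> length p" if "subpath q p" for q p :: "'a list"
    using that by (auto simp: subpath_def dest: sublist_length_le)
  then have "length q = length p" using assms by (simp add: le_antisym)
  then show ?thesis using assms(1)
    by (auto simp: subpath_def sublist_def)
qed

lemma finite_path_edges [simp]: "finite (path_edges p)"
  by (induction p rule: path_edges.induct) auto

lemma path_edges_subset_set: "e \<in> path_edges p \<Longrightarrow> e \<subseteq> set p"
  by (auto simp: path_edges_iff)

lemma vertex_on_path_edge:
  assumes "z \<in> set p" "hd p \<noteq> last p"
  obtains e where "e \<in> path_edges p" "z \<in> e"
proof -
  obtain xs ys where p: "p = xs @ z # ys" using assms(1) by (auto simp: in_set_conv_decomp)
  show ?thesis
  proof (cases ys)
    case (Cons y ys')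
    then show ?thesis using p that[of "{z, y}"] by (auto simp: path_edges_iff)
  next
    case Nil
    then have "xs \<noteq> []" using assms(2) p by auto
    then have "p = butlast xs @ last xs # z # []" using p Nil by simp
    then have "{last xs, z} \<in> path_edges p" unfolding path_edges_iff by blast
    then show ?thesis using that by blast
  qed
qed

section \<open>Distances represented by a path choice function\<close>

context
  fixes V :: "'a set" and E :: "'a set set" and W :: "'a set \<Rightarrow> real"
    and d :: "'a \<Rightarrow> 'a \<Rightarrow> real" and g :: "'a \<Rightarrow> 'a \<Rightarrow> 'a list"
  assumes graph: "weighted_graph V E W" and rep: "represented_by V E W d g"
begin

lemma represented_dist:
  "v \<in> V \<Longrightarrow> w \<in> V \<Longrightarrow> d v w = (if v = w then 0 else path_cost W (g v w))"
  using rep by (simp add: represented_by_def)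

lemma represented_path:
  assumes "v \<in> V" "w \<in> V"
  shows "g v w \<noteq> []" "hd (g v w) = v" "last (g v w) = w" "distinct (g v w)" "set (g v w) \<subseteq> V"
    "path_edges (g v w) \<subseteq> E"
  using rep assms by (auto simp: represented_by_def path_choice_function_def paths_def)

lemma endpoints_on_path:
  assumes "v \<in> V" "w \<in> V"
  shows "v \<in> set (g v w)" "w \<in> set (g v w)"
  using represented_path[OF assms] by (metis hd_in_set, metis last_in_set)

lemma represented_subpath:
  assumes "v \<in> V" "w \<in> V" "a \<in> set (g v w)" "b \<in> set (g v w)"
  shows "subpath (g a b) (g v w)"
  using rep assms by (auto simp: represented_by_def path_choice_function_def)

text \<open>Both endpoints of \<open>g v w\<close> lie on \<open>g w v\<close> and conversely, so
  consistency yields equal edge sets and hence equal costs.\<close>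

lemma represented_sym:
  assumes "v \<in> V" "w \<in> V"
  shows "d v w = d w v"
proof -
  have "path_edges (g v w) \<subseteq> path_edges (g w v)" "path_edges (g w v) \<subseteq> path_edges (g v w)"
    using path_edges_subpath[OF represented_subpath] assms endpoints_on_path by blast+
  then show ?thesis using assms by (simp add: represented_dist path_cost_def)
qed

text \<open>If \<open>g a b\<close> contained both \<open>v\<close> and \<open>w\<close>,
  consistency would make the two paths equal up to reversal and force the same endpoints. So it
  misses an endpoint, and with it an edge.\<close>

lemma path_edges_inner_psubset:
  assumes vw: "v \<in> V" "w \<in> V" "v \<noteq> w" and ab: "a \<in> set (g v w)" "b \<in> set (g v w)"
    and ne: "{a, b} \<noteq> {v, w}"
  shows "path_edges (g a b) \<subset> path_edges (g v w)"
proof -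
  have abV: "a \<in> V" "b \<in> V" using ab represented_path(5)[OF vw(1,2)] by auto
  have sub: "subpath (g a b) (g v w)" using represented_subpath vw(1,2) ab .
  have "\<not> (v \<in> set (g a b) \<and> w \<in> set (g a b))"
  proof
    assume "v \<in> set (g a b) \<and> w \<in> set (g a b)"
    then have "subpath (g v w) (g a b)" using represented_subpath[OF abV] by blast
    then have "g a b = g v w \<or> g a b = rev (g v w)" using sub subpath_antisym by blast
    then have "hd (g a b) = v \<and> last (g a b) = w \<or> hd (g a b) = w \<and> last (g a b) = v"
      using represented_path(1-3)[OF vw(1,2)] by (auto simp: hd_rev last_rev)
    then show False using represented_path(2,3)[OF abV] ne by auto
  qed
  then obtain z where z: "z \<in> set (g v w)" "z \<notin> set (g a b)"
    using endpoints_on_path[OF vw(1,2)] by auto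
  moreover have "hd (g v w) \<noteq> last (g v w)" using represented_path[OF vw(1,2)] vw(3) by simp
  ultimately obtain e where "e \<in> path_edges (g v w)" "z \<in> e" by (metis vertex_on_path_edge)
  then show ?thesis using path_edges_subpath[OF sub] path_edges_subset_set z(2) by blast
qed

lemma path_cost_psubset:
  assumes "path_edges q \<subset> path_edges p" "path_edges p \<subseteq> E"
  shows "path_cost W q < path_cost W p"
proof -
  have pos: "0 < W e" if "e \<in> path_edges p" for e
    using that assms(2) graph by (auto simp: weighted_graph_def)
  obtain e where e: "e \<in> path_edges p - path_edges q" using assms(1) by auto
  show ?thesis
    unfolding path_cost_def
    using assms(1) e pos by (intro sum_strict_mono2[of _ _ e]) (auto intro: less_imp_le)
qed

lemma represented_dist_pos:
  assumes "v \<in> V" "w \<in> V" "v \<noteq> w"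
  shows "d v w > 0"
proof -
  have "path_edges (g v w) \<noteq> {}"
    using vertex_on_path_edge[of v "g v w"] endpoints_on_path(1)[OF assms(1,2)] assms(3)
      represented_path(2,3)[OF assms(1,2)] by (metis empty_iff)
  then have "path_cost W [] < path_cost W (g v w)"
    using assms represented_path by (intro path_cost_psubset) auto
  then show ?thesis using assms by (simp add: represented_dist path_cost_def)
qed

lemma filtration_value_pair:
  assumes "v \<in> V" "w \<in> V" "v \<noteq> w"
  shows "filtration_value d {v, w} = d v w"
proof (rule antisym)
  have card: "card {v, w} \<ge> 2" using assms by simp
  show "filtration_value d {v, w} \<le> d v w"
    using assms represented_sym[of v w] represented_dist_pos[of v w]
    by (auto simp: filtration_value_le_iff[OF card] represented_dist)
  show "d v w \<le> filtration_value d {v, w}"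
    using filtration_value_le_iff[OF card, of d "filtration_value d {v, w}"] by simp
qed

definition "direct_edges = {{v, w} | v w. v \<in> V \<and> w \<in> V \<and> v \<noteq> w \<and> g v w = [v, w]}"

lemma direct_edges_subset: "direct_edges \<subseteq> E"
proof
  fix e assume "e \<in> direct_edges"
  then obtain v w where "e = {v, w}" "v \<in> V" "w \<in> V" "g v w = [v, w]"
    by (auto simp: direct_edges_def)
  then show "e \<in> E" using represented_path(6)[of v w] by simp
qed

lemma filtration_value_direct:
  assumes "e \<in> direct_edges"
  shows "filtration_value d e = W e"
proof -
  obtain v w where "e = {v, w}" "v \<in> V" "w \<in> V" "v \<noteq> w" "g v w = [v, w]"
    using assms by (auto simp: direct_edges_def)
  then show ?thesis by (simp add: filtration_value_pair represented_dist path_cost_def)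
qed

lemma exists_inner_vertex:
  assumes vw: "v \<in> V" "w \<in> V" "v \<noteq> w" and "{v, w} \<notin> direct_edges"
  obtains x where "x \<in> set (g v w)" "x \<noteq> v" "x \<noteq> w"
proof -
  have "\<not> set (g v w) \<subseteq> {v, w}"
  proof
    assume "set (g v w) \<subseteq> {v, w}"
    then have "length (g v w) \<le> 2"
      using distinct_card[OF represented_path(4)[OF vw(1,2)]] card_mono[of "{v, w}" "set (g v w)"] vw(3)
      by simp
    then have "g v w = [v, w]"
      using represented_path(1-3)[OF vw(1,2)] vw(3)
      by (cases "g v w" rule: path_edges.cases) auto
    then show False using assms by (auto simp: direct_edges_def)
  qed
  then show ?thesis using that by auto
qed

text \<open>Cone off at an inner vertex \<open>x\<close> of the chosen path; the pairs \<open>{v, x}\<close> and \<open>{x, w}\<close> have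
  shorter paths and strictly smaller distances.\<close>

lemma exists_filling:
  assumes "v \<in> V" "w \<in> V" "v \<noteq> w"
  shows "\<exists>c. (\<forall>t\<in>triangles V. c t \<noteq> 0 \<longrightarrow> filtration_value d t \<le> d v w) \<and>
    (\<forall>a\<in>vertex_pairs V. chain_boundary V c a + of_bool (a = {v, w}) \<noteq> 0 \<longrightarrow>
       a \<in> direct_edges \<and> W a \<le> d v w \<and> ({v, w} \<notin> direct_edges \<longrightarrow> W a < d v w))"
  using assms
proof (induction "card (path_edges (g v w))" arbitrary: v w rule: less_induct)
  case (less v w)
  note vw = less.prems
  show ?case
  proof (cases "{v, w} \<in> direct_edges")
    case True
    then have "W {v, w} = d v w"
      using filtration_value_direct[OF True] filtration_value_pair[OF vw] by simp
    \<comment> \<open>The zero chain suffices: the pair is its own residue, and strictness is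
      demanded only of pairs that are not direct.\<close>
    then show ?thesis using True
      by (intro exI[of _ "\<lambda>_. 0"]) (auto simp: chain_boundary_def)
  next
    case False
    then obtain x where x: "x \<in> set (g v w)" "x \<noteq> v" "x \<noteq> w"
      using exists_inner_vertex vw by blast
    have xV: "x \<in> V" using x(1) represented_path(5)[OF vw(1,2)] by auto
    note ends = endpoints_on_path[OF vw(1,2)]
    have sub: "path_edges (g v x) \<subset> path_edges (g v w)" "path_edges (g x w) \<subset> path_edges (g v w)"
      using x ends by (intro path_edges_inner_psubset[OF vw]; auto simp: doubleton_eq_iff)+
    have "path_cost W (g v x) < path_cost W (g v w)" "path_cost W (g x w) < path_cost W (g v w)"
      using sub represented_path(6)[OF vw(1,2)] path_cost_psubset by auto
    then have less: "d v x < d v w" "d x w < d v w"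
      using vw x xV by (auto simp: represented_dist)
    obtain c1 where c1: "\<And>t. t \<in> triangles V \<Longrightarrow> c1 t \<noteq> 0 \<Longrightarrow> filtration_value d t \<le> d v x"
      "\<And>a. a \<in> vertex_pairs V \<Longrightarrow> chain_boundary V c1 a + of_bool (a = {v, x}) \<noteq> 0 \<Longrightarrow>
         a \<in> direct_edges \<and> W a \<le> d v x"
      using less.hyps[OF psubset_card_mono[OF finite_path_edges sub(1)] vw(1) xV x(2)[symmetric]]
      by blast
    obtain c2 where c2: "\<And>t. t \<in> triangles V \<Longrightarrow> c2 t \<noteq> 0 \<Longrightarrow> filtration_value d t \<le> d x w"
      "\<And>a. a \<in> vertex_pairs V \<Longrightarrow> chain_boundary V c2 a + of_bool (a = {x, w}) \<noteq> 0 \<Longrightarrow>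
         a \<in> direct_edges \<and> W a \<le> d x w"
      using less.hyps[OF psubset_card_mono[OF finite_path_edges sub(2)] xV vw(2) x(3)]
      by blast
    \<comment> \<open>The triangle \<open>s\<close> trades \<open>{v, w}\<close> for
      \<open>{v, x}\<close> and \<open>{x, w}\<close>, which the two chains from the induction
      replace by direct edges.\<close>
    define s where "s = {v, x, w}"
    have s: "s \<in> triangles V" using vw x xV by (simp add: s_def triangles_def)
    have "d x v = d v x" "d w x = d x w" "d w v = d v w"
      using represented_sym vw xV by blast+
    moreover have "d v v = 0" "d x x = 0" "d w w = 0"
      using vw xV by (simp_all add: represented_dist)
    ultimately have "filtration_value d s \<le> d v w"
      using filtration_value_le_iff[of s d "d v w"] s less represented_dist_pos[OF vw]
      by (simp add: s_def triangles_def)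
    define c where "c = (\<lambda>t. c1 t + c2 t + of_bool (t = s))"
    have bdry: "chain_boundary V c a + of_bool (a = {v, w}) =
        (chain_boundary V c1 a + of_bool (a = {v, x})) + (chain_boundary V c2 a + of_bool (a = {x, w}))"
      if a: "a \<in> vertex_pairs V" for a
    proof -
      have "a \<subseteq> s \<longleftrightarrow> a = {v, x} \<or> a = {x, w} \<or> a = {v, w}"
        using a by (auto simp: s_def vertex_pairs_def card_2_iff doubleton_eq_iff)
      then have "(of_bool (a \<subseteq> s) :: bit) =
          of_bool (a = {v, x}) + of_bool (a = {x, w}) + of_bool (a = {v, w})"
        using vw(3) x(2,3) by (auto simp: doubleton_eq_iff)
      moreover have "finite V" using graph by (simp add: weighted_graph_def)
      ultimately have "chain_boundary V c a = chain_boundary V c1 a + chain_boundary V c2 a +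
          (of_bool (a = {v, x}) + of_bool (a = {x, w}) + of_bool (a = {v, w}))"
        using s by (simp add: c_def chain_boundary_add chain_boundary_indicator)
      then show ?thesis by (simp add: ac_simps)
    qed
    show ?thesis
    proof (intro exI[of _ c] conjI ballI impI)
      fix t assume t: "t \<in> triangles V" "c t \<noteq> 0"
      then consider "c1 t \<noteq> 0" | "c2 t \<noteq> 0" | "t = s"
        by (cases "c1 t = 0"; cases "c2 t = 0"; cases "t = s") (auto simp: c_def)
      then show "filtration_value d t \<le> d v w"
        using c1(1)[OF t(1)] c2(1)[OF t(1)] less \<open>filtration_value d s \<le> d v w\<close> by cases auto
    next
      fix a assume a: "a \<in> vertex_pairs V" "chain_boundary V c a + of_bool (a = {v, w}) \<noteq> 0"
      then consider "chain_boundary V c1 a + of_bool (a = {v, x}) \<noteq> 0"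
        | "chain_boundary V c2 a + of_bool (a = {x, w}) \<noteq> 0"
        using bdry[OF a(1)] by fastforce
      then have "a \<in> direct_edges \<and> W a < d v w"
        using c1(2)[OF a(1)] c2(2)[OF a(1)] less by cases auto
      then show "a \<in> direct_edges" "W a \<le> d v w" "W a < d v w" by auto
    qed
  qed
qed

lemma generating_edges_direct: "generating_edges V W d direct_edges"
  unfolding generating_edges_def
proof (intro conjI ballI)
  fix e assume "e \<in> vertex_pairs V - direct_edges"
  then obtain v w where e: "e = {v, w}" "v \<in> V" "w \<in> V" "v \<noteq> w" "{v, w} \<notin> direct_edges"
    by (auto simp: vertex_pairs_def card_2_iff)
  show "\<exists>c. (\<forall>t\<in>triangles V. c t \<noteq> 0 \<longrightarrow> filtration_value d t \<le> filtration_value d e) \<and>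
        (\<forall>a\<in>vertex_pairs V. chain_boundary V c a + of_bool (a = e) \<noteq> 0 \<longrightarrow>
           a \<in> direct_edges \<and> W a < filtration_value d e)"
    unfolding e(1) filtration_value_pair[OF e(2-4)]
    by (rule ex_forward[OF exists_filling[OF e(2-4)]]) (use e(5) in blast)
qed (rule filtration_value_direct)

end

text \<open>This collects what the comparison of barcodes takes from a path choice function. Cost
  domination gives the bound by \<open>W\<close> on all of \<open>E\<close>, so it also covers the
  generating edges of another distance.\<close>

lemma cost_dominated_generating_edges:
  assumes "weighted_graph V E W" "cost_dominated_path_representable V E W d"
  obtains N where "N \<subseteq> E" "generating_edges V W d N" "\<forall>e\<in>E. filtration_value d e \<le> W e"
proof -
  obtain g where g: "represented_by V E W d g"
    and dom: "\<And>v w. {v, w} \<in> E \<Longrightarrow> g v w \<noteq> [v, w] \<Longrightarrow> path_cost W (g v w) \<le> W {v, w}"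
    using assms(2) by (auto simp: cost_dominated_path_representable_def)
  have "filtration_value d e \<le> W e" if "e \<in> E" for e
  proof -
    have "e \<subseteq> V" "card e = 2" using assms(1) \<open>e \<in> E\<close> by (auto simp: weighted_graph_def)
    then obtain v w where e: "e = {v, w}" "v \<in> V" "w \<in> V" "v \<noteq> w" by (auto simp: card_2_iff)
    have "path_cost W (g v w) \<le> W {v, w}"
      using dom[of v w] \<open>e \<in> E\<close> e(1) by (cases "g v w = [v, w]") (auto simp: path_cost_def)
    then show ?thesis
      using e filtration_value_pair[OF assms(1) g e(2-4)] represented_dist[OF assms(1) g e(2,3)]
      by simp
  qed
  then show ?thesis
    using that direct_edges_subset[OF assms(1) g] generating_edges_direct[OF assms(1) g] by blast
qed

section \<open>Counting birth edges and comparing deaths\<close>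

definition crosses :: "'a set \<Rightarrow> 'a set \<Rightarrow> bool" where
  "crosses S e \<longleftrightarrow> e \<inter> S \<noteq> {} \<and> \<not> e \<subseteq> S"

text \<open>A triangle has an even number of edges between \<open>S\<close> and its complement.\<close>

lemma boundary_crosses_evenly:
  assumes "finite V"
  shows "(\<Sum>e\<in>{e \<in> vertex_pairs V. crosses S e}. chain_boundary V c e) = 0"
proof -
  let ?P = "{e \<in> vertex_pairs V. crosses S e}"
  have "(\<Sum>e\<in>?P. chain_boundary V c e) = (\<Sum>t\<in>triangles V. \<Sum>e\<in>{e \<in> ?P. e \<subseteq> t}. c t)"
    unfolding chain_boundary_def using assms by (intro sum.swap_restrict) auto
  also have "\<dots> = 0"
  proof (rule sum.neutral, rule ballI)
    fix t assume t: "t \<in> triangles V"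
    then obtain x y z where xyz: "t = {x, y, z}" "x \<noteq> y" "y \<noteq> z" "x \<noteq> z"
      by (auto simp: triangles_def card_3_iff)
    have "{e \<in> vertex_pairs V. e \<subseteq> t} = {{x, y}, {y, z}, {x, z}}"
      using t xyz by (auto simp: vertex_pairs_def triangles_def card_2_iff doubleton_eq_iff)
    moreover have "{e \<in> ?P. e \<subseteq> t} = {e \<in> {e \<in> vertex_pairs V. e \<subseteq> t}. crosses S e}"
      by auto
    ultimately have "{e \<in> ?P. e \<subseteq> t} = {e \<in> {{x, y}, {y, z}, {x, z}}. crosses S e}"
      by (simp only:)
    moreover have "(\<Sum>e\<in>{e \<in> {{x, y}, {y, z}, {x, z}}. crosses S e}. c t) =
        (\<Sum>e\<in>{{x, y}, {y, z}, {x, z}}. if crosses S e then c t else 0)"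
      by (rule sum.inter_filter) simp
    moreover have "\<dots> = 0"
      using xyz by (cases "x \<in> S"; cases "y \<in> S"; cases "z \<in> S")
        (simp_all add: doubleton_eq_iff crosses_def)
    ultimately show "(\<Sum>e\<in>{e \<in> ?P. e \<subseteq> t}. c t) = 0" by simp
  qed
  finally show ?thesis .
qed

text \<open>\<open>\<sigma>\<close> contributes 1 to an even sum over the pairs across the cut, so
  the boundary has another such pair, which must precede \<open>\<sigma>\<close>.\<close>

lemma dies_by_crossing_smaller:
  assumes "finite V" "dies_by V d \<pi> \<sigma> s" "\<sigma> \<in> vertex_pairs V" "crosses S \<sigma>"
  obtains e where "e \<in> vertex_pairs V" "crosses S e" "simplex_less d \<pi> e \<sigma>"
proof -
  obtain c where c: "chain_boundary V c \<sigma> \<noteq> 0"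
    "\<And>e. e \<in> vertex_pairs V \<Longrightarrow> chain_boundary V c e \<noteq> 0 \<Longrightarrow> e \<noteq> \<sigma> \<Longrightarrow> simplex_less d \<pi> e \<sigma>"
    using assms(2) unfolding dies_by_def by blast
  let ?P = "{e \<in> vertex_pairs V. crosses S e}"
  have "chain_boundary V c \<sigma> + (\<Sum>e\<in>?P - {\<sigma>}. chain_boundary V c e) = 0"
    using boundary_crosses_evenly[OF assms(1), of c S] assms
    by (subst sum.remove[symmetric]) auto
  then have "(\<Sum>e\<in>?P - {\<sigma>}. chain_boundary V c e) \<noteq> 0" using c(1) by (metis add.right_neutral)
  then obtain e where "e \<in> ?P - {\<sigma>}" "chain_boundary V c e \<noteq> 0"
    by (rule sum.not_neutral_contains_not_neutral)
  then show ?thesis using that c(2) by blast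
qed

section \<open>Birth edges and generating edges\<close>

lemma dies_by_mono: "dies_by V d \<pi> \<sigma> s \<Longrightarrow> s \<le> s' \<Longrightarrow> dies_by V d \<pi> \<sigma> s'"
  unfolding dies_by_def by (meson order_trans)

lemma simplex_less_pair:
  assumes "e \<in> vertex_pairs V" "\<sigma> \<in> vertex_pairs V"
  shows "simplex_less d \<pi> e \<sigma> \<longleftrightarrow>
    filtration_value d e < filtration_value d \<sigma> \<or>
    filtration_value d e = filtration_value d \<sigma> \<and> e \<noteq> \<sigma> \<and> (e, \<sigma>) \<in> \<pi>"
  using assms by (auto simp: simplex_less_def vertex_pairs_def)

lemma generating_edgesE:
  assumes "generating_edges V W d N" "e \<in> vertex_pairs V - N"
  obtains c where
    "\<forall>t\<in>triangles V. c t \<noteq> 0 \<longrightarrow> filtration_value d t \<le> filtration_value d e"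
    "\<forall>a\<in>vertex_pairs V. chain_boundary V c a + of_bool (a = e) \<noteq> 0 \<longrightarrow>
       a \<in> N \<and> W a < filtration_value d e"
  using bspec[OF conjunct2[OF assms(1)[unfolded generating_edges_def]] assms(2)]
  by (elim exE conjE) (rule that)

text \<open>The boundary of a filling of \<open>\<sigma>\<close> for \<open>d\<close> has
  \<open>\<sigma>\<close> and otherwise only cheaper edges of \<open>N\<close>, which stay cheaper
  under \<open>d'\<close>. With \<open>d' = d\<close> and \<open>\<epsilon> = 0\<close> this gives
  death at birth; with a larger \<open>d'\<close> it bounds the life of a pair that is not
  generating for \<open>d\<close>.\<close>

lemma dies_by_filling:
  assumes N: "N \<subseteq> vertex_pairs V" "generating_edges V W d N"
    and \<sigma>: "\<sigma> \<in> vertex_pairs V - N"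
    and cheap: "\<And>e. e \<in> N \<Longrightarrow> filtration_value d' e \<le> W e"
    and \<sigma>_le: "filtration_value d \<sigma> \<le> filtration_value d' \<sigma>"
    and close: "\<And>t. t \<in> triangles V \<Longrightarrow> filtration_value d' t \<le> filtration_value d t + \<epsilon>"
  shows "dies_by V d' \<pi> \<sigma> (filtration_value d \<sigma> + \<epsilon>)"
proof -
  obtain c where "\<forall>t\<in>triangles V. c t \<noteq> 0 \<longrightarrow> filtration_value d t \<le> filtration_value d \<sigma>"
    "\<forall>a\<in>vertex_pairs V. chain_boundary V c a + of_bool (a = \<sigma>) \<noteq> 0 \<longrightarrow>
      a \<in> N \<and> W a < filtration_value d \<sigma>"
    by (rule generating_edgesE[OF N(2) \<sigma>])
  note c = this[rule_format]
  show ?thesis unfolding dies_by_def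
  proof (intro exI[of _ c] conjI ballI impI)
    show "filtration_value d' t \<le> filtration_value d \<sigma> + \<epsilon>" if "t \<in> triangles V" "c t \<noteq> 0" for t
      using c(1)[OF that] close[OF that(1)] by simp
    \<comment> \<open>Otherwise the residue of the filling would contain \<open>\<sigma>\<close>
      itself, which lies outside \<open>N\<close>.\<close>
    show "chain_boundary V c \<sigma> \<noteq> 0"
    proof
      assume "chain_boundary V c \<sigma> = 0"
      then show False using c(2)[of \<sigma>] \<sigma> by simp
    qed
    fix e assume e: "e \<in> vertex_pairs V" "chain_boundary V c e \<noteq> 0" "e \<noteq> \<sigma>"
    then have "e \<in> N \<and> W e < filtration_value d \<sigma>" using c(2)[of e] by simp
    then have "filtration_value d' e < filtration_value d' \<sigma>"
      using cheap[of e] \<sigma>_le by linarith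
    then show "simplex_less d' \<pi> e \<sigma>" by (simp add: simplex_less_def)
  qed
qed

lemma non_generating_dies_at_birth:
  assumes "N \<subseteq> vertex_pairs V" "generating_edges V W d N" "\<sigma> \<in> vertex_pairs V - N"
  shows "dies_by V d \<pi> \<sigma> (filtration_value d \<sigma>)"
  using dies_by_filling[OF assms, of d 0] assms(2) by (auto simp: generating_edges_def)

text \<open>Death bounds attain their minimum by \<open>dies_by_least\<close>, so a positive
  lifetime amounts to not dying at birth.\<close>

lemma birth_edges_iff:
  assumes "finite V" "simplex_ordering V \<pi>"
  shows "\<sigma> \<in> birth_edges (barcode1 V d \<pi>) \<longleftrightarrow>
    \<sigma> \<in> vertex_pairs V \<and> (\<exists>s. dies_by V d \<pi> \<sigma> s) \<and> \<not> dies_by V d \<pi> \<sigma> (filtration_value d \<sigma>)"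
proof
  assume "\<sigma> \<in> birth_edges (barcode1 V d \<pi>)"
  then obtain \<beta> \<delta> where "(\<sigma>, \<beta>, \<delta>) \<in> barcode1 V d \<pi>" by (force simp: birth_edges_def)
  then show "\<sigma> \<in> vertex_pairs V \<and> (\<exists>s. dies_by V d \<pi> \<sigma> s) \<and>
      \<not> dies_by V d \<pi> \<sigma> (filtration_value d \<sigma>)"
    unfolding barcode1_iff[OF assms] by (meson not_le)
next
  assume *: "\<sigma> \<in> vertex_pairs V \<and> (\<exists>s. dies_by V d \<pi> \<sigma> s) \<and>
      \<not> dies_by V d \<pi> \<sigma> (filtration_value d \<sigma>)"
  then obtain \<delta> where \<delta>: "dies_by V d \<pi> \<sigma> \<delta>" "\<And>s. dies_by V d \<pi> \<sigma> s \<Longrightarrow> \<delta> \<le> s"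
    using dies_by_least[OF assms] by blast
  then have "filtration_value d \<sigma> < \<delta>" using * dies_by_mono by (meson not_le)
  then have "(\<sigma>, filtration_value d \<sigma>, \<delta>) \<in> barcode1 V d \<pi>"
    using * \<delta> by (simp add: barcode1_iff[OF assms])
  then show "\<sigma> \<in> birth_edges (barcode1 V d \<pi>)" by (force simp: birth_edges_def)
qed

text \<open>An edge carries only one interval, so the definite descriptions in \<open>birth\<close>
  and \<open>death\<close> pick it out.\<close>

lemma birth_edges_barcode:
  assumes "finite V" "simplex_ordering V \<pi>" "\<sigma> \<in> birth_edges (barcode1 V d \<pi>)"
  shows "birth (barcode1 V d \<pi>) \<sigma> = filtration_value d \<sigma>"
    and "filtration_value d \<sigma> < death (barcode1 V d \<pi>) \<sigma>"
    and "dies_by V d \<pi> \<sigma> (death (barcode1 V d \<pi>) \<sigma>)"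
    and "\<And>s. dies_by V d \<pi> \<sigma> s \<Longrightarrow> death (barcode1 V d \<pi>) \<sigma> \<le> s"
proof -
  note iff = barcode1_iff[OF assms(1,2)]
  obtain \<beta> \<delta> where *: "(\<sigma>, \<beta>, \<delta>) \<in> barcode1 V d \<pi>"
    using assms(3) by (force simp: birth_edges_def)
  have uniq: "\<beta>' = filtration_value d \<sigma> \<and> \<delta>' = \<delta>" if "(\<sigma>, \<beta>', \<delta>') \<in> barcode1 V d \<pi>" for \<beta>' \<delta>'
    using * that unfolding iff by (meson antisym)
  have "birth (barcode1 V d \<pi>) \<sigma> = \<beta>" unfolding birth_def
    by (rule the_equality) (use * uniq in blast)+
  moreover have "death (barcode1 V d \<pi>) \<sigma> = \<delta>" unfolding death_def
    by (rule the_equality) (use * uniq in blast)+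
  ultimately show "birth (barcode1 V d \<pi>) \<sigma> = filtration_value d \<sigma>"
    "filtration_value d \<sigma> < death (barcode1 V d \<pi>) \<sigma>"
    "dies_by V d \<pi> \<sigma> (death (barcode1 V d \<pi>) \<sigma>)"
    "\<And>s. dies_by V d \<pi> \<sigma> s \<Longrightarrow> death (barcode1 V d \<pi>) \<sigma> \<le> s"
    using * unfolding iff by auto
qed

lemma birth_edges_generating:
  assumes "finite V" "simplex_ordering V \<pi>" "N \<subseteq> vertex_pairs V" "generating_edges V W d N"
  shows "birth_edges (barcode1 V d \<pi>) \<subseteq> N"
proof
  fix \<sigma> assume "\<sigma> \<in> birth_edges (barcode1 V d \<pi>)"
  then show "\<sigma> \<in> N"
    using non_generating_dies_at_birth[OF assms(3,4), of \<sigma> \<pi>]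
    unfolding birth_edges_iff[OF assms(1,2)] by blast
qed

section \<open>Counting the birth edges\<close>

text \<open>This is the spanning tree bound: a vertex set is grown from one vertex, each time across
  an edge of \<open>F\<close> leaving it.\<close>

lemma card_ge_if_all_cuts_crossed:
  assumes "finite V" "V \<noteq> {}" "finite F"
    and cut: "\<And>S. S \<subset> V \<Longrightarrow> S \<noteq> {} \<Longrightarrow> \<exists>e\<in>F. e \<in> vertex_pairs V \<and> crosses S e"
  shows "card V \<le> card F + 1"
proof -
  \<comment> \<open>The crossing edge has an endpoint outside the old set, so each growth step adds
    one vertex and at least one new edge.\<close>
  have "\<exists>S\<subseteq>V. card S = Suc k \<and> k \<le> card {e \<in> F. e \<subseteq> S}" if "k < card V" for k
    using that
  proof (induction k)
    case 0
    obtain v where "v \<in> V" using assms(2) by auto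
    then show ?case by (intro exI[of _ "{v}"]) auto
  next
    case (Suc k)
    then obtain S where S: "S \<subseteq> V" "card S = Suc k" "k \<le> card {e \<in> F. e \<subseteq> S}" by auto
    then have "S \<subset> V" "S \<noteq> {}" using Suc.prems by auto
    then obtain e where e: "e \<in> F" "e \<in> vertex_pairs V" "crosses S e" using cut by blast
    then obtain x y where xy: "e = {x, y}" "x \<in> S" "y \<notin> S" "y \<in> V"
      by (auto simp: vertex_pairs_def card_2_iff crosses_def)
    have fin: "finite S" using S(1) assms(1) finite_subset by blast
    have "insert e {e \<in> F. e \<subseteq> S} \<subseteq> {e \<in> F. e \<subseteq> insert y S}" using e xy by auto
    then have "card (insert e {e \<in> F. e \<subseteq> S}) \<le> card {e \<in> F. e \<subseteq> insert y S}"
      using assms(3) by (intro card_mono) auto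
    moreover have "e \<notin> {e \<in> F. e \<subseteq> S}" using xy by auto
    ultimately have "Suc k \<le> card {e \<in> F. e \<subseteq> insert y S}" using S(3) assms(3) by simp
    then show ?case using S xy fin by (intro exI[of _ "insert y S"]) auto
  qed
  from this[of "card V - 1"] obtain S where "card V - 1 \<le> card {e \<in> F. e \<subseteq> S}"
    using assms(1,2) by (auto simp: card_gt_0_iff)
  moreover have "card {e \<in> F. e \<subseteq> S} \<le> card F" using assms(3) by (intro card_mono) auto
  ultimately show ?thesis by simp
qed

text \<open>The smallest pair across a cut never dies, so it belongs to \<open>E\<close> and is not a birth edge.\<close>

lemma card_birth_edges_le:
  assumes V: "finite V" "V \<noteq> {}" "simplex_ordering V \<pi>"
    and E: "E \<subseteq> vertex_pairs V" and N: "N \<subseteq> E" "generating_edges V W d N"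
  shows "card (birth_edges (barcode1 V d \<pi>)) + card V \<le> card E + 1"
proof -
  let ?B = "birth_edges (barcode1 V d \<pi>)"
  have NV: "N \<subseteq> vertex_pairs V" using N(1) E by blast
  have finE: "finite E" using E V(1) finite_subset finite_vertex_pairs by blast
  have BE: "?B \<subseteq> E" using birth_edges_generating[OF V(1,3) NV N(2)] N(1) by blast
  have "card V \<le> card (E - ?B) + 1"
  proof (rule card_ge_if_all_cuts_crossed[OF V(1,2)])
    show "finite (E - ?B)" using finE by simp
    fix S assume S: "S \<subset> V" "S \<noteq> {}"
    let ?P = "{e \<in> vertex_pairs V. crosses S e}"
    obtain x y where "x \<in> S" "y \<in> V" "y \<notin> S" using S by blast
    moreover from this have "x \<noteq> y" by blast
    ultimately have "{x, y} \<in> ?P" using S by (auto simp: vertex_pairs_def crosses_def)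
    then have "?P \<noteq> {}" by blast
    have sub: "?P \<subseteq> full_complex V" by (auto simp: vertex_pairs_def full_complex_def)
    have trans: "transp_on ?P (simplex_less d \<pi>)"
      using transp_on_simplex_less[OF V(1,3)] sub by (rule transp_on_subset)
    have asym: "asymp_on ?P (simplex_less d \<pi>)"
    proof (rule asymp_onI)
      fix e e' assume "e \<in> ?P" "e' \<in> ?P" "simplex_less d \<pi> e e'"
      then show "\<not> simplex_less d \<pi> e' e"
        using transp_onD[OF trans, of e e' e] simplex_less_irrefl[of d \<pi> e] by blast
    qed
    have "finite ?P" using V(1) by simp
    from Finite_Set.bex_min_element[OF this asym trans \<open>?P \<noteq> {}\<close>] obtain \<sigma> where \<sigma>: "\<sigma> \<in> ?P" "\<forall>e\<in>?P. e \<noteq> \<sigma> \<longrightarrow> \<not> simplex_less d \<pi> e \<sigma>"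
      by (rule bexE)
    have \<sigma>P: "\<sigma> \<in> vertex_pairs V" "crosses S \<sigma>" using \<sigma>(1) by auto
    have immortal: "\<not> dies_by V d \<pi> \<sigma> s" for s
    proof
      assume "dies_by V d \<pi> \<sigma> s"
      from dies_by_crossing_smaller[OF V(1) this \<sigma>P] obtain e
        where e: "e \<in> vertex_pairs V" "crosses S e" "simplex_less d \<pi> e \<sigma>" .
      then have "e \<noteq> \<sigma>" using simplex_less_irrefl by metis
      then show False using \<sigma>(2) e by simp
    qed
    then have "\<sigma> \<notin> ?B" by (simp add: birth_edges_iff[OF V(1,3)])
    \<comment> \<open>A pair outside \<open>N\<close> would die at its birth.\<close>
    moreover have "\<sigma> \<in> N"
      using non_generating_dies_at_birth[OF NV N(2), of \<sigma> \<pi>] \<sigma>P(1) immortal by blast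
    ultimately show "\<exists>e\<in>E - ?B. e \<in> vertex_pairs V \<and> crosses S e" using \<sigma>P N(1) by blast
  qed
  moreover have "card (E - ?B) = card E - card ?B" "card ?B \<le> card E"
    using BE finE by (auto intro: card_Diff_subset card_mono finite_subset)
  ultimately show ?thesis by simp
qed

section \<open>Comparing deaths for two distances\<close>

text \<open>The same chain works: no value grows and \<open>\<sigma>\<close> keeps its own, so a
  boundary edge that ties with \<open>\<sigma>\<close> under \<open>d\<close> already tied under
  \<open>d'\<close>, where \<open>\<pi>\<close> placed it first.\<close>

lemma dies_by_smaller_dist:
  assumes "dies_by V d' \<pi> \<sigma> s" "\<sigma> \<in> vertex_pairs V"
    and le: "\<And>\<tau>. \<tau> \<in> triangles V \<union> vertex_pairs V \<Longrightarrow> filtration_value d \<tau> \<le> filtration_value d' \<tau>"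
    and eq: "filtration_value d \<sigma> = filtration_value d' \<sigma>"
  shows "dies_by V d \<pi> \<sigma> s"
proof -
  obtain c where c: "\<And>t. t \<in> triangles V \<Longrightarrow> c t \<noteq> 0 \<Longrightarrow> filtration_value d' t \<le> s"
    "chain_boundary V c \<sigma> \<noteq> 0"
    "\<And>e. e \<in> vertex_pairs V \<Longrightarrow> chain_boundary V c e \<noteq> 0 \<Longrightarrow> e \<noteq> \<sigma> \<Longrightarrow> simplex_less d' \<pi> e \<sigma>"
    using assms(1) unfolding dies_by_def by blast
  show ?thesis unfolding dies_by_def
  proof (intro exI[of _ c] conjI ballI impI)
    show "filtration_value d t \<le> s" if "t \<in> triangles V" "c t \<noteq> 0" for t
      using c(1)[OF that] le[of t] that(1) by auto
    show "simplex_less d \<pi> e \<sigma>"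
      if "e \<in> vertex_pairs V" "chain_boundary V c e \<noteq> 0" "e \<noteq> \<sigma>" for e
      using c(3)[OF that] le[of e] that(1) eq unfolding simplex_less_pair[OF that(1) assms(2)] by auto
  qed (rule c(2))
qed

text \<open>Replacing every pair outside \<open>N\<close> in the boundary by cheaper edges of \<open>N\<close>, on which \<open>d\<close> and
  \<open>d'\<close> agree, makes \<open>\<sigma>\<close> the last boundary edge for \<open>d'\<close> as well.\<close>

lemma dies_by_larger_dist:
  assumes V: "finite V" and N: "N \<subseteq> vertex_pairs V" "generating_edges V W d N"
    and dies: "dies_by V d \<pi> \<sigma> s" and \<sigma>: "\<sigma> \<in> N"
    and eq: "\<And>e. e \<in> N \<Longrightarrow> filtration_value d' e = W e"
    and close: "\<And>t. t \<in> triangles V \<Longrightarrow> filtration_value d' t \<le> filtration_value d t + \<epsilon>"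
  shows "dies_by V d' \<pi> \<sigma> (s + \<epsilon>)"
proof -
  have \<sigma>V: "\<sigma> \<in> vertex_pairs V" using N(1) \<sigma> by blast
  have eq': "filtration_value d e = W e" if "e \<in> N" for e
    using N(2) that by (simp add: generating_edges_def)
  obtain c where c: "\<And>t. t \<in> triangles V \<Longrightarrow> c t \<noteq> 0 \<Longrightarrow> filtration_value d t \<le> s"
    "chain_boundary V c \<sigma> \<noteq> 0"
    "\<And>e. e \<in> vertex_pairs V \<Longrightarrow> chain_boundary V c e \<noteq> 0 \<Longrightarrow> e \<noteq> \<sigma> \<Longrightarrow> simplex_less d \<pi> e \<sigma>"
    using dies unfolding dies_by_def by blast
  \<comment> \<open>The boundary pairs that have to be replaced.\<close>
  define X where "X = {e \<in> vertex_pairs V - N. chain_boundary V c e \<noteq> 0}"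
  have finX: "finite X" using V by (simp add: X_def)
  have X: "filtration_value d e \<le> s" "filtration_value d e \<le> W \<sigma>" if "e \<in> X" for e
  proof -
    have e: "e \<in> vertex_pairs V" "e \<notin> N" "chain_boundary V c e \<noteq> 0" using that by (auto simp: X_def)
    obtain t where t: "t \<in> triangles V" "e \<subseteq> t" "c t \<noteq> 0"
      using sum.not_neutral_contains_not_neutral[OF e(3)[unfolded chain_boundary_def]] by blast
    have "finite t" using t(1) V finite_subset by (auto simp: triangles_def)
    then have "filtration_value d e \<le> filtration_value d t"
      using t(2) e(1) by (intro filtration_value_mono) (auto simp: vertex_pairs_def)
    then show "filtration_value d e \<le> s" using c(1)[OF t(1,3)] by simp
    have "simplex_less d \<pi> e \<sigma>" using c(3) e \<sigma> by blast
    then show "filtration_value d e \<le> W \<sigma>"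
      using simplex_less_pair[OF e(1) \<sigma>V] eq'[OF \<sigma>] by auto
  qed
  have "\<forall>e\<in>X. \<exists>c. (\<forall>t\<in>triangles V. c t \<noteq> 0 \<longrightarrow> filtration_value d t \<le> filtration_value d e) \<and>
        (\<forall>a\<in>vertex_pairs V. chain_boundary V c a + of_bool (a = e) \<noteq> 0 \<longrightarrow>
           a \<in> N \<and> W a < filtration_value d e)"
  proof
    fix e assume "e \<in> X"
    then have "e \<in> vertex_pairs V - N" by (simp add: X_def)
    then show "\<exists>c. (\<forall>t\<in>triangles V. c t \<noteq> 0 \<longrightarrow> filtration_value d t \<le> filtration_value d e) \<and>
        (\<forall>a\<in>vertex_pairs V. chain_boundary V c a + of_bool (a = e) \<noteq> 0 \<longrightarrow>
           a \<in> N \<and> W a < filtration_value d e)"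
      by (rule generating_edgesE[OF N(2)]) (intro exI conjI)
  qed
  from bchoice[OF this] obtain h where
    "\<forall>e\<in>X. (\<forall>t\<in>triangles V. h e t \<noteq> 0 \<longrightarrow> filtration_value d t \<le> filtration_value d e) \<and>
        (\<forall>a\<in>vertex_pairs V. chain_boundary V (h e) a + of_bool (a = e) \<noteq> 0 \<longrightarrow>
           a \<in> N \<and> W a < filtration_value d e)"
    ..
  note h = bspec[OF this, THEN conjunct1, rule_format] bspec[OF this, THEN conjunct2, rule_format]
  define c' where "c' = (\<lambda>t. c t + (\<Sum>e\<in>X. h e t))"
  have bdry: "chain_boundary V c' a = chain_boundary V c a + (\<Sum>e\<in>X. chain_boundary V (h e) a)" for a
    by (simp add: c'_def chain_boundary_add chain_boundary_sum)
  \<comment> \<open>A filling does not touch edges of \<open>N\<close> at least as expensive as the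
    pair it fills. Since \<open>\<sigma>\<close> is such an edge for all of \<open>X\<close>, its
    coefficient survives.\<close>
  have in_N: "chain_boundary V (h e) a = 0" if "a \<in> N" "e \<in> X" "filtration_value d e \<le> W a" for a e
  proof (rule ccontr)
    assume nz: "chain_boundary V (h e) a \<noteq> 0"
    have "a \<noteq> e" using that by (auto simp: X_def)
    then show False using h(2)[OF that(2), of a] nz that N(1) by auto
  qed
  \<comment> \<open>Outside \<open>N\<close> the boundary of a filling is just the filled pair, so
    the fillings over \<open>X\<close> repeat the boundary of \<open>c\<close> there and cancel
    it.\<close>
  have outside_N: "chain_boundary V c' a = 0" if a: "a \<in> vertex_pairs V" "a \<notin> N" for a
  proof -
    have "chain_boundary V (h e) a = (if e = a then 1 else 0)" if "e \<in> X" for e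
    proof -
      have "chain_boundary V (h e) a + of_bool (a = e) = 0" using h(2)[OF that a(1)] a(2) by blast
      then show ?thesis by (cases "chain_boundary V (h e) a"; cases "a = e") simp_all
    qed
    then have "(\<Sum>e\<in>X. chain_boundary V (h e) a) = (\<Sum>e\<in>X. if e = a then 1 else 0)"
      by (rule sum.cong[OF refl])
    also have "\<dots> = (if a \<in> X then 1 else 0)" using finX by simp
    also have "\<dots> = chain_boundary V c a" using a by (auto simp: X_def)
    finally show ?thesis by (simp add: bdry)
  qed
  show ?thesis unfolding dies_by_def
  proof (intro exI[of _ c'] conjI ballI impI)
    fix t assume t: "t \<in> triangles V" "c' t \<noteq> 0"
    have "filtration_value d t \<le> s"
    proof (cases "c t = 0")
      case True
      then have "(\<Sum>e\<in>X. h e t) \<noteq> 0" using t(2) by (simp add: c'_def)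
      then obtain e where "e \<in> X" "h e t \<noteq> 0" by (rule sum.not_neutral_contains_not_neutral)
      then show ?thesis using h(1) t(1) X(1) by (meson order_trans)
    qed (use c(1) t(1) in blast)
    then show "filtration_value d' t \<le> s + \<epsilon>" using close[OF t(1)] by simp
  next
    show "chain_boundary V c' \<sigma> \<noteq> 0" using c(2) in_N[OF \<sigma>] X(2) by (simp add: bdry)
  next
    fix a assume a: "a \<in> vertex_pairs V" "chain_boundary V c' a \<noteq> 0" "a \<noteq> \<sigma>"
    then have aN: "a \<in> N" using outside_N by blast
    have "simplex_less d \<pi> a \<sigma>"
    proof (cases "chain_boundary V c a = 0")
      case True
      then have "(\<Sum>e\<in>X. chain_boundary V (h e) a) \<noteq> 0" using a(2) bdry by simp
      then obtain e where e: "e \<in> X" "chain_boundary V (h e) a \<noteq> 0"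
        by (rule sum.not_neutral_contains_not_neutral)
      \<comment> \<open>\<open>a\<close> is strictly cheaper than the filled pair \<open>e\<close>,
        whose value is at most \<open>W \<sigma>\<close>.\<close>
      then have "W a < W \<sigma>" using in_N[OF aN e(1)] X(2)[OF e(1)] by linarith
      then show ?thesis using eq' aN \<sigma> by (simp add: simplex_less_def)
    qed (use c(3) a in blast)
    then show "simplex_less d' \<pi> a \<sigma>"
      using eq eq' aN \<sigma> simplex_less_pair[OF a(1) \<sigma>V] by auto
  qed
qed

section \<open>The bound on the total persistence difference\<close>

theorem theorem6p2:
  fixes V :: "'a set" and E :: "'a set set" and W :: "'a set \<Rightarrow> real"
    and d\<^sub>i d\<^sub>j :: "'a \<Rightarrow> 'a \<Rightarrow> real" and \<pi> :: "'a set rel" and p :: real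
  assumes "weighted_graph V E W" and "connected_graph V E"
    and "cost_dominated_path_representable V E W d\<^sub>i"
    and "cost_dominated_path_representable V E W d\<^sub>j"
    and "\<forall>v\<in>V. \<forall>w\<in>V. d\<^sub>i v w \<le> d\<^sub>j v w"
    and "p \<ge> 1"
    and "simplex_ordering V \<pi>"
    and "birth_edges (barcode1 V d\<^sub>i \<pi>) \<subseteq> birth_edges (barcode1 V d\<^sub>j \<pi>)"
  shows "pers_diff p (barcode1 V d\<^sub>j \<pi>) (barcode1 V d\<^sub>i \<pi>)
           \<le> (real (card E) - real (card V) + 1) powr (1 / p) * sup_dist V d\<^sub>j d\<^sub>i"
proof -
  have V: "finite V" "V \<noteq> {}" and E: "E \<subseteq> vertex_pairs V"
    using assms(1,2) by (auto simp: weighted_graph_def connected_graph_def vertex_pairs_def)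
  note ord = assms(7)
  define \<epsilon> where "\<epsilon> = sup_dist V d\<^sub>j d\<^sub>i"
  let ?Bi = "barcode1 V d\<^sub>i \<pi>" and ?Bj = "barcode1 V d\<^sub>j \<pi>"
  obtain Ni where Ni: "Ni \<subseteq> E" "generating_edges V W d\<^sub>i Ni" "\<forall>e\<in>E. filtration_value d\<^sub>i e \<le> W e"
    using cost_dominated_generating_edges[OF assms(1,3)] .
  obtain Nj where Nj: "Nj \<subseteq> E" "generating_edges V W d\<^sub>j Nj" "\<forall>e\<in>E. filtration_value d\<^sub>j e \<le> W e"
    using cost_dominated_generating_edges[OF assms(1,4)] .
  have NiV: "Ni \<subseteq> vertex_pairs V" using Ni(1) E by auto
  have diff_le: "d\<^sub>j v w - d\<^sub>i v w \<le> \<epsilon>" if "v \<in> V" "w \<in> V" for v w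
    unfolding \<epsilon>_def sup_dist_def
  proof (rule Max_ge)
    have "{d\<^sub>j v w - d\<^sub>i v w | v w. v \<in> V \<and> w \<in> V} = (\<lambda>(v, w). d\<^sub>j v w - d\<^sub>i v w) ` (V \<times> V)" by auto
    then show "finite {d\<^sub>j v w - d\<^sub>i v w | v w. v \<in> V \<and> w \<in> V}" using V(1) by simp
  qed (use that in blast)
  obtain v where "v \<in> V" using V(2) by blast
  then have \<epsilon>: "0 \<le> \<epsilon>" using diff_le[of v v] assms(5) by fastforce
  have le: "filtration_value d\<^sub>i \<tau> \<le> filtration_value d\<^sub>j \<tau>"
    and close: "filtration_value d\<^sub>j \<tau> \<le> filtration_value d\<^sub>i \<tau> + \<epsilon>"
    if \<tau>: "\<tau> \<in> triangles V \<union> vertex_pairs V" for \<tau>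
  proof -
    have card: "card \<tau> \<ge> 2" and sub: "\<tau> \<subseteq> V" using \<tau> by (auto simp: triangles_def vertex_pairs_def)
    have "d\<^sub>i v w \<le> filtration_value d\<^sub>i \<tau>" "d\<^sub>j v w \<le> filtration_value d\<^sub>j \<tau>" if "v \<in> \<tau>" "w \<in> \<tau>" for v w
      using filtration_value_le_iff[OF card] that by blast+
    then show "filtration_value d\<^sub>i \<tau> \<le> filtration_value d\<^sub>j \<tau>"
      "filtration_value d\<^sub>j \<tau> \<le> filtration_value d\<^sub>i \<tau> + \<epsilon>"
      unfolding filtration_value_le_iff[OF card]
      using sub assms(5) diff_le by (smt (verit) subsetD)+
  qed
  have eq: "filtration_value d\<^sub>i e = W e" "filtration_value d\<^sub>j e = W e" if "e \<in> Ni" for e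
  proof -
    show "filtration_value d\<^sub>i e = W e" using Ni(2) that by (simp add: generating_edges_def)
    moreover have "filtration_value d\<^sub>j e \<le> W e" using Nj(3) Ni(1) that by blast
    ultimately show "filtration_value d\<^sub>j e = W e" using le[of e] NiV that by force
  qed
  have dies_j: "dies_by V d\<^sub>j \<pi> \<sigma> (s + \<epsilon>)" if "dies_by V d\<^sub>i \<pi> \<sigma> s" "\<sigma> \<in> Ni" for \<sigma> s
    using dies_by_larger_dist[OF V(1) NiV Ni(2) that eq(2) close] by blast
  have dies_i: "dies_by V d\<^sub>i \<pi> \<sigma> s" if "dies_by V d\<^sub>j \<pi> \<sigma> s" "\<sigma> \<in> Ni" for \<sigma> s
    using dies_by_smaller_dist[OF that(1) _ le] eq that(2) NiV by auto
  have common: "0 \<le> death ?Bj \<sigma> - death ?Bi \<sigma>" "death ?Bj \<sigma> - death ?Bi \<sigma> \<le> \<epsilon>"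
    if \<sigma>: "\<sigma> \<in> birth_edges ?Bi" for \<sigma>
  proof -
    have N: "\<sigma> \<in> Ni" using birth_edges_generating[OF V(1) ord NiV Ni(2)] \<sigma> by blast
    note bi = birth_edges_barcode[OF V(1) ord \<sigma>]
    note bj = birth_edges_barcode[OF V(1) ord subsetD[OF assms(8) \<sigma>]]
    show "0 \<le> death ?Bj \<sigma> - death ?Bi \<sigma>" using bi(4)[OF dies_i[OF bj(3) N]] by simp
    show "death ?Bj \<sigma> - death ?Bi \<sigma> \<le> \<epsilon>" using bj(4)[OF dies_j[OF bi(3) N]] by simp
  qed
  have new: "0 \<le> death ?Bj \<sigma> - birth ?Bj \<sigma>" "death ?Bj \<sigma> - birth ?Bj \<sigma> \<le> \<epsilon>"
    if \<sigma>: "\<sigma> \<in> birth_edges ?Bj - birth_edges ?Bi" for \<sigma>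
  proof -
    have \<sigma>j: "\<sigma> \<in> birth_edges ?Bj" using \<sigma> by blast
    note bj = birth_edges_barcode[OF V(1) ord \<sigma>j]
    have \<sigma>V: "\<sigma> \<in> vertex_pairs V" using \<sigma>j birth_edges_iff[OF V(1) ord] by blast
    have "dies_by V d\<^sub>j \<pi> \<sigma> (filtration_value d\<^sub>i \<sigma> + \<epsilon>)"
    proof (cases "\<sigma> \<in> Ni")
      case True
      \<comment> \<open>The edge dies for \<open>d\<^sub>j\<close>, hence for
        \<open>d\<^sub>i\<close>; not being a birth edge there, it must die at its birth.\<close>
      have "dies_by V d\<^sub>i \<pi> \<sigma> (filtration_value d\<^sub>i \<sigma>)"
        using \<sigma> dies_i[OF bj(3) True] \<sigma>V birth_edges_iff[OF V(1) ord] by blast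
      then show ?thesis using dies_j True by blast
    next
      case False
      show ?thesis
      proof (rule dies_by_filling[OF NiV Ni(2)])
        show "filtration_value d\<^sub>j e \<le> W e" if "e \<in> Ni" for e using eq(2)[OF that] by simp
      qed (use False \<sigma>V le close in auto)
    qed
    then have "death ?Bj \<sigma> \<le> filtration_value d\<^sub>i \<sigma> + \<epsilon>" by (rule bj(4))
    \<comment> \<open>The birth for \<open>d\<^sub>j\<close> is no earlier than the value for
      \<open>d\<^sub>i\<close>, so the bound passes to the lifetime.\<close>
    then show "death ?Bj \<sigma> - birth ?Bj \<sigma> \<le> \<epsilon>" using bj(1) le[of \<sigma>] \<sigma>V by simp
    show "0 \<le> death ?Bj \<sigma> - birth ?Bj \<sigma>" using bj(1,2) by simp
  qed
  have finB: "finite (birth_edges ?Bj)"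
    using birth_edges_iff[OF V(1) ord] finite_vertex_pairs[OF V(1)]
    by (meson finite_subset subsetI)
  define m where "m = real (card E) - real (card V) + 1"
  \<comment> \<open>Besides counting, this makes \<open>m\<close> nonnegative, which lets the power
    of the product be split at the end.\<close>
  have m: "real (card (birth_edges ?Bj)) \<le> m"
    using card_birth_edges_le[OF V ord E Nj(1,2)] by (simp add: m_def)
  let ?S = "(\<Sum>\<sigma>\<in>birth_edges ?Bi. (death ?Bj \<sigma> - death ?Bi \<sigma>) powr p) +
      (\<Sum>\<sigma>\<in>birth_edges ?Bj - birth_edges ?Bi. (death ?Bj \<sigma> - birth ?Bj \<sigma>) powr p)"
  have "?S \<le> (\<Sum>\<sigma>\<in>birth_edges ?Bi. \<epsilon> powr p) + (\<Sum>\<sigma>\<in>birth_edges ?Bj - birth_edges ?Bi. \<epsilon> powr p)"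
    using common new assms(6) by (intro add_mono sum_mono powr_mono2) auto
  \<comment> \<open>Common and new birth edges partition the birth edges for
    \<open>d\<^sub>j\<close>.\<close>
  also have "\<dots> = (\<Sum>\<sigma>\<in>birth_edges ?Bj. \<epsilon> powr p)"
    using sum.subset_diff[OF assms(8) finB, of "\<lambda>_. \<epsilon> powr p"] by simp
  also have "\<dots> \<le> m * \<epsilon> powr p" using m by (simp add: mult_right_mono)
  finally have "?S powr (1 / p) \<le> (m * \<epsilon> powr p) powr (1 / p)"
    using assms(6) by (intro powr_mono2) (auto intro!: add_nonneg_nonneg sum_nonneg)
  also have "\<dots> = m powr (1 / p) * \<epsilon>"
    using m \<epsilon> assms(6) by (simp add: powr_mult powr_powr)
  finally show ?thesis by (simp add: pers_diff_def m_def \<epsilon>_def)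
qed

end
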